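(* For the path $\mathcal P=\mathcal P_1\cup\mathcal P_2\cup\mathcal P_3$ (which passes through $z_0$), we have $\operatorname{Re}(p(z)-p(z_0))>0$ for all $z\in\mathcal P$ with $z\neq z_0$.
   Context: $\operatorname{Li}_2$ is the principal branch of the dilogarithm, $\log$ the principal logarithm. $p(z):=\dfrac{\operatorname{Li}_2(1)-\operatorname{Li}_2(e^{2\pi i z})}{2\pi i z}$. $w_0$ is the unique solution $w\in\mathbb C\setminus((-\infty,0]\cup[1,\infty))$ of $\operatorname{Li}_2(w)-2\pi i\log w=0$ ($w_0\approx 0.9161978-0.1824589i$), and $z_0:=1+\log(1-w_0)/(2\pi i)$ ($z_0\approx 1.181+0.255i$). Let $v:=\operatorname{Im}(z_0)/\operatorname{Re}(z_0)$ and $c:=1+iv$. $\mathcal P_1$ is the vertical segment from $1.01$ to $1.01c$, $\mathcal P_2=\{ct : 1.01\le t\le1.49\}$ is the segment from $1.01c$ to $1.49c$, and $\mathcal P_3$ is the vertical segment from $1.49c$ to $1.49$. *)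

theory Defs
  imports "HOL-Complex_Analysis.Complex_Analysis"
begin

text \<open>
  Principal branch of the dilogarithm, cut along the real half-line from 1 to infinity:
  minus the integral of \<open>log (1 - u) / u\<close> along the straight segment from 0 to \<open>z\<close>.
  On the unit disc this is the sum of \<open>z ^ n / n\<^sup>2\<close> over \<open>n \<ge> 1\<close>.
  The integrand is given the value 0 at the removable singularity \<open>u = 0\<close>, which is a single
  endpoint and does not matter. For \<open>z = 1\<close> the logarithmic singularity at the endpoint is
  integrable (contour integrals are gauge integrals), so \<open>Li2 1 = pi\<^sup>2 / 6\<close>.
\<close>

definition Li2 :: "complex \<Rightarrow> complex" where
  "Li2 z = - contour_integral (linepath 0 z) (\<lambda>u. Ln (1 - u) / u)"

definition p :: "complex \<Rightarrow> complex" where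
  "p z = (Li2 1 - Li2 (exp (2 * pi * \<i> * z))) / (2 * pi * \<i> * z)"

definition w\<^sub>0 :: complex where
  "w\<^sub>0 = (THE w. w \<in> - (complex_of_real ` ({..0} \<union> {1..})) \<and> Li2 w - 2 * pi * \<i> * Ln w = 0)"

definition z\<^sub>0 :: complex where
  "z\<^sub>0 = 1 + Ln (1 - w\<^sub>0) / (2 * pi * \<i>)"

definition v :: real where
  "v = Im z\<^sub>0 / Re z\<^sub>0"

definition c :: complex where
  "c = 1 + \<i> * v"

definition P\<^sub>1 :: "complex set" where
  "P\<^sub>1 = closed_segment 1.01 (1.01 * c)"

definition P\<^sub>2 :: "complex set" where
  "P\<^sub>2 = {c * of_real t | t. 1.01 \<le> t \<and> t \<le> 1.49}"

definition P\<^sub>3 :: "complex set" where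
  "P\<^sub>3 = closed_segment (1.49 * c) 1.49"

definition \<P> :: "complex set" where
  "\<P> = P\<^sub>1 \<union> P\<^sub>2 \<union> P\<^sub>3"

end

theory Submission
  imports Defs "HOL-Real_Asymp.Real_Asymp"
begin

text \<open>
  Writing \<open>w = exp \<zeta>\<close>, the equation for \<open>w\<^sub>0\<close> becomes the fixed point equation
  \<open>\<zeta> = Li2 (exp \<zeta>) / (2 \<pi> i)\<close>, whose right-hand side has derivative \<open>- Ln (1 - w) / (2 \<pi> i)\<close>.
  Elementary estimates of the integral of \<open>- Ln (1 - t w) / t\<close> exclude solutions outside the lower half
  of the unit disc and confine those inside to a box which the map contracts into itself. This gives
  existence and uniqueness, and, with one numerical evaluation, a small disc containing \<open>w\<^sub>0\<close>.

  The reflection formula yields \<open>p z\<^sub>0 = Ln w\<^sub>0\<close>. On a ray \<open>z = (1 + i s) t\<close> the derivative of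
  \<open>t Re (p z)\<close> in \<open>t\<close> is \<open>ln |1 - exp (2 \<pi> i z)|\<close>. On the middle segment (\<open>s = v\<close>) this is smaller than
  \<open>ln |w\<^sub>0|\<close> before \<open>z\<^sub>0\<close> and larger after it, since \<open>|1 - exp (2 \<pi> i z)|\<close> first increases and then
  exceeds 1. The points of the vertical segments are reached along rays of slope \<open>s \<le> v\<close>
  from \<open>t = 1\<close> and from \<open>t = 3/2\<close>, where the exponential is real.
\<close>

section \<open>The dilogarithm series\<close>

text \<open>The term \<open>n = 0\<close> is \<open>1 / 0 = 0\<close>, so the sum effectively starts
  at \<open>n = 1\<close> without an index shift.\<close>

definition dilog_series :: "complex \<Rightarrow> complex" where
  "dilog_series z = (\<Sum>n. 1 / (of_nat n)\<^sup>2 * z ^ n)"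

lemma dilog_series_0 [simp]: "dilog_series 0 = 0"
  using suminf_finite[of "{}" "\<lambda>n. 1 / (of_nat n)\<^sup>2 * (0::complex) ^ n"]
  by (simp add: dilog_series_def power_0_left)

lemma inverse_squares_sums': "(\<lambda>n. 1 / (real n)\<^sup>2) sums (pi\<^sup>2 / 6)"
  using inverse_squares_sums sums_Suc_iff[of "\<lambda>n. 1 / (real n)\<^sup>2" "pi\<^sup>2 / 6"]
  by (simp add: add.commute)

lemma norm_dilog_term_le:
  fixes z :: complex
  assumes "norm z \<le> 1"
  shows "norm (1 / (of_nat n)\<^sup>2 * z ^ n) \<le> 1 / (real n)\<^sup>2"
proof -
  have "norm (1 / (of_nat n)\<^sup>2 * z ^ n) = 1 / (real n)\<^sup>2 * norm z ^ n"
    by (simp add: norm_mult norm_divide norm_power)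
  also have "\<dots> \<le> 1 / (real n)\<^sup>2 * 1"
    using assms by (intro mult_left_mono power_le_one) auto
  finally show ?thesis by simp
qed

lemma summable_dilog_series:
  fixes z :: complex
  assumes "norm z \<le> 1"
  shows "summable (\<lambda>n. 1 / (of_nat n)\<^sup>2 * z ^ n)"
  by (rule summable_comparison_test'[OF sums_summable[OF inverse_squares_sums']])
     (use norm_dilog_term_le[OF assms] in blast)

lemma continuous_on_dilog_series: "continuous_on (cball 0 1) dilog_series"
proof (rule uniform_limit_theorem)
  show "\<forall>\<^sub>F N in sequentially. continuous_on (cball 0 1) (\<lambda>z::complex. \<Sum>n<N. 1 / (of_nat n)\<^sup>2 * z ^ n)"
    by (intro always_eventually allI continuous_intros)
  show "uniform_limit (cball 0 1) (\<lambda>N z. \<Sum>n<N. 1 / (of_nat n)\<^sup>2 * z ^ n) dilog_series sequentially"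
    unfolding dilog_series_def
    by (rule Weierstrass_m_test[OF _ sums_summable[OF inverse_squares_sums']])
       (use norm_dilog_term_le in auto)
qed simp

lemma sums_Ln_minus:
  fixes z :: complex
  assumes "norm z < 1"
  shows "(\<lambda>n. z ^ n / of_nat n) sums (- Ln (1 - z))"
  using sums_minus[OF Ln_series'[of "- z"]] assms by simp

lemma dilog_series_has_field_derivative:
  assumes "norm z < 1" "z \<noteq> 0"
  shows "(dilog_series has_field_derivative - Ln (1 - z) / z) (at z)"
proof -
  have D: "(dilog_series has_field_derivative (\<Sum>n. diffs (\<lambda>n. 1 / (of_nat n)\<^sup>2) n * z ^ n)) (at z)"
    unfolding dilog_series_def
    by (rule termdiffs_strong[where K = 1]) (use summable_dilog_series[of 1] assms in auto)
  have "(\<lambda>n. z ^ Suc n / of_nat (Suc n)) sums (- Ln (1 - z))"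
    using sums_Ln_minus[OF assms(1)] sums_Suc_iff[of "\<lambda>n. z ^ n / of_nat n" "- Ln (1 - z)"] by simp
  then have "(\<lambda>n. z ^ Suc n / of_nat (Suc n) / z) sums (- Ln (1 - z) / z)"
    by (rule sums_divide)
  also have "(\<lambda>n. z ^ Suc n / of_nat (Suc n) / z) = (\<lambda>n. diffs (\<lambda>n. 1 / (of_nat n)\<^sup>2) n * z ^ n)"
    using assms(2) by (auto simp: diffs_def fun_eq_iff power2_eq_square simp del: of_nat_Suc)
  finally show ?thesis using D by (simp add: sums_iff)
qed

text \<open>Continuity up to the unit circle lets the fundamental theorem of calculus absorb both the junk
  value of the integrand at 0 and, for \<open>z = 1\<close>, its logarithmic singularity.\<close>

lemma Li2_eq_dilog_series:
  assumes "norm z \<le> 1"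
  shows "Li2 z = dilog_series z"
proof (cases "z = 0")
  case True
  have "contour_integral (linepath 0 0) (\<lambda>u. Ln (1 - u) / u) = 0"
    by (metis contour_integral_trivial)
  then show ?thesis using True by (simp add: Li2_def)
next
  case False
  have "((\<lambda>t. z * (- Ln (1 - of_real t * z) / (of_real t * z))) has_integral
      (dilog_series (of_real 1 * z) - dilog_series (of_real 0 * z))) {0..1}"
  proof (rule fundamental_theorem_of_calculus_interior)
    show "continuous_on {0..1} (\<lambda>t::real. dilog_series (of_real t * z))"
      by (rule continuous_on_compose2[OF continuous_on_dilog_series])
         (use assms in \<open>auto intro!: continuous_intros simp: norm_mult mult_le_one\<close>)
  next
    fix t :: real assume t: "t \<in> {0<..<1}"
    have "t * norm z \<le> t * 1"
      using t assms by (intro mult_left_mono) auto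
    also have "\<dots> < 1" using t by simp
    finally have "norm (of_real t * z) < 1"
      using t by (simp add: norm_mult)
    then have "(dilog_series has_field_derivative - Ln (1 - of_real t * z) / (of_real t * z)) (at (of_real t * z))"
      using t False by (intro dilog_series_has_field_derivative) auto
    moreover have "((\<lambda>t. of_real t * z) has_vector_derivative z) (at t)"
      by (auto intro!: derivative_eq_intros)
    ultimately show "((\<lambda>t. dilog_series (of_real t * z)) has_vector_derivative
        z * (- Ln (1 - of_real t * z) / (of_real t * z))) (at t)"
      using field_vector_diff_chain_at[of "\<lambda>t. of_real t * z" z t dilog_series]
      by (simp only: o_def)
  qed simp
  from has_integral_neg[OF this]
  have "((\<lambda>u. Ln (1 - u) / u) has_contour_integral (- dilog_series z)) (linepath 0 z)"
    unfolding has_contour_integral_linepath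
    by (simp add: linepath_def scaleR_conv_of_real mult.commute)
  then show ?thesis by (simp add: Li2_def contour_integral_unique)
qed

lemma Li2_sums:
  assumes "norm z \<le> 1"
  shows "(\<lambda>n. 1 / (of_nat n)\<^sup>2 * z ^ n) sums Li2 z"
  using summable_dilog_series[OF assms] Li2_eq_dilog_series[OF assms]
  by (simp add: dilog_series_def summable_sums)

lemma Li2_0 [simp]: "Li2 0 = 0"
  by (simp add: Li2_eq_dilog_series)

lemma continuous_on_Li2: "continuous_on (cball 0 1) Li2"
  using continuous_on_dilog_series by (rule continuous_on_eq) (simp add: Li2_eq_dilog_series)

lemma Li2_has_field_derivative:
  assumes "norm z < 1" "z \<noteq> 0"
  shows "(Li2 has_field_derivative - Ln (1 - z) / z) (at z)"
  by (rule has_field_derivative_transform_within_open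
        [OF dilog_series_has_field_derivative[OF assms] open_ball[of 0 1]])
     (use assms in \<open>auto simp: Li2_eq_dilog_series\<close>)

lemma Li2_1: "Li2 1 = of_real (pi\<^sup>2 / 6)"
proof -
  have "(\<lambda>n. of_real (1 / (real n)\<^sup>2) :: complex) sums of_real (pi\<^sup>2 / 6)"
    using inverse_squares_sums' by (simp only: sums_of_real_iff)
  then show ?thesis
    using Li2_sums[of 1] sums_unique2 by fastforce
qed

section \<open>Explicit truncation errors for the two series\<close>

lemma norm_Li2_minus_partial_sum_le:
  assumes "norm z \<le> 1"
  shows "norm (Li2 z - (\<Sum>n<k. 1 / (of_nat n)\<^sup>2 * z ^ n)) \<le> pi\<^sup>2 / 6 - (\<Sum>n<k. 1 / (real n)\<^sup>2)"
proof -
  have 1: "(\<lambda>n. 1 / (of_nat (n + k))\<^sup>2 * z ^ (n + k)) sums (Li2 z - (\<Sum>n<k. 1 / (of_nat n)\<^sup>2 * z ^ n))"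
    using Li2_sums[OF assms] by (rule sums_split_initial_segment)
  have 2: "(\<lambda>n. 1 / (real (n + k))\<^sup>2) sums (pi\<^sup>2 / 6 - (\<Sum>n<k. 1 / (real n)\<^sup>2))"
    using inverse_squares_sums' by (rule sums_split_initial_segment)
  \<comment> \<open>Up to the unit circle the tail is dominated by the tail at 1, which is
    \<open>pi\<^sup>2 / 6\<close> minus a partial sum.\<close>
  have "norm (\<Sum>n. 1 / (of_nat (n + k))\<^sup>2 * z ^ (n + k)) \<le> (\<Sum>n. 1 / (real (n + k))\<^sup>2)"
    by (rule norm_suminf_le[OF norm_dilog_term_le[OF assms] sums_summable[OF 2]])
  then show ?thesis using 1 2 by (simp add: sums_iff)
qed

text \<open>Strictly inside the disc the weights in the tail are at most
  \<open>1 / k\<^sup>2\<close>, which leaves a geometric series. At \<open>x_approx\<close>, of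
  modulus about 0.2, it is small after a few terms.\<close>

lemma norm_Li2_minus_partial_sum_le_geometric:
  assumes "norm z < 1" "0 < k"
  shows "norm (Li2 z - (\<Sum>n<k. 1 / (of_nat n)\<^sup>2 * z ^ n)) \<le> norm z ^ k / ((real k)\<^sup>2 * (1 - norm z))"
proof -
  have 1: "(\<lambda>n. 1 / (of_nat (n + k))\<^sup>2 * z ^ (n + k)) sums (Li2 z - (\<Sum>n<k. 1 / (of_nat n)\<^sup>2 * z ^ n))"
    using assms by (intro sums_split_initial_segment Li2_sums) auto
  have 2: "(\<lambda>n. norm z ^ k / (real k)\<^sup>2 * norm z ^ n) sums (norm z ^ k / (real k)\<^sup>2 * (1 / (1 - norm z)))"
    using assms by (intro sums_mult geometric_sums) auto
  have "norm (\<Sum>n. 1 / (of_nat (n + k))\<^sup>2 * z ^ (n + k)) \<le> (\<Sum>n. norm z ^ k / (real k)\<^sup>2 * norm z ^ n)"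
  proof (rule norm_suminf_le[OF _ sums_summable[OF 2]])
    fix n
    have "norm (1 / (of_nat (n + k))\<^sup>2 * z ^ (n + k)) = norm z ^ k * norm z ^ n / (real (n + k))\<^sup>2"
      by (simp add: norm_mult norm_divide norm_power power_add mult_ac flip: of_nat_add)
    also have "\<dots> \<le> norm z ^ k * norm z ^ n / (real k)\<^sup>2"
      using assms by (intro divide_left_mono power_mono) auto
    finally show "norm (1 / (of_nat (n + k))\<^sup>2 * z ^ (n + k)) \<le> norm z ^ k / (real k)\<^sup>2 * norm z ^ n"
      by simp
  qed
  then show ?thesis using 1 2 by (simp add: sums_iff)
qed

lemma norm_Ln_minus_partial_sum_le:
  fixes z :: complex
  assumes "norm z < 1" "0 < k"
  shows "norm (- Ln (1 - z) - (\<Sum>n<k. z ^ n / of_nat n)) \<le> norm z ^ k / (real k * (1 - norm z))"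
proof -
  have 1: "(\<lambda>n. z ^ (n + k) / of_nat (n + k)) sums (- Ln (1 - z) - (\<Sum>n<k. z ^ n / of_nat n))"
    using assms by (intro sums_split_initial_segment sums_Ln_minus) auto
  have 2: "(\<lambda>n. norm z ^ k / real k * norm z ^ n) sums (norm z ^ k / real k * (1 / (1 - norm z)))"
    using assms by (intro sums_mult geometric_sums) auto
  have "norm (\<Sum>n. z ^ (n + k) / of_nat (n + k)) \<le> (\<Sum>n. norm z ^ k / real k * norm z ^ n)"
  proof (rule norm_suminf_le[OF _ sums_summable[OF 2]])
    fix n
    have "norm (z ^ (n + k) / of_nat (n + k)) = norm z ^ k * norm z ^ n / real (n + k)"
      by (simp add: norm_mult norm_divide norm_power power_add mult_ac flip: of_nat_add)
    also have "\<dots> \<le> norm z ^ k * norm z ^ n / real k"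
      using assms by (intro divide_left_mono) auto
    finally show "norm (z ^ (n + k) / of_nat (n + k)) \<le> norm z ^ k / real k * norm z ^ n"
      by simp
  qed
  then show ?thesis using 1 2 by (simp add: sums_iff)
qed

lemma norm_Li2_le:
  assumes "norm z \<le> 1"
  shows "norm (Li2 z) \<le> pi\<^sup>2 / 6"
  using norm_Li2_minus_partial_sum_le[OF assms, of 0] by simp

section \<open>The reflection formula and an integral representation\<close>

lemma one_minus_notin_nonpos_Reals:
  fixes z :: complex
  assumes "norm z < 1"
  shows "1 - z \<notin> \<real>\<^sub>\<le>\<^sub>0"
  using assms complex_Re_le_cmod[of z] by (auto simp: complex_nonpos_Reals_iff)

text \<open>The left-hand side has derivative zero on the convex lens \<open>?S\<close>. Its
  constant value is the limit at 0 along the reals: \<open>Li2\<close> is continuous up to the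
  circle, and \<open>ln s * ln (1 - s)\<close> tends to 0.\<close>

lemma Li2_reflection:
  assumes "norm w < 1" "norm (1 - w) < 1"
  shows "Li2 w + Li2 (1 - w) + Ln w * Ln (1 - w) = of_real (pi\<^sup>2 / 6)"
proof -
  define f where "f w = Li2 w + Li2 (1 - w) + Ln w * Ln (1 - w)" for w
  let ?S = "ball 0 1 \<inter> ball 1 1 :: complex set"
  have "\<exists>k. \<forall>w\<in>?S. f w = k"
  proof (rule has_field_derivative_zero_constant)
    fix z :: complex assume "z \<in> ?S"
    then have z: "norm z < 1" "norm (1 - z) < 1" by (auto simp: dist_norm norm_minus_commute)
    then have nz: "z \<noteq> 0" "1 - z \<noteq> 0" by auto
    have "z \<notin> \<real>\<^sub>\<le>\<^sub>0" "1 - z \<notin> \<real>\<^sub>\<le>\<^sub>0"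
      using one_minus_notin_nonpos_Reals[of "1 - z"] one_minus_notin_nonpos_Reals[of z] z by auto
    then have "(f has_field_derivative - Ln (1 - z) / z + (- Ln (1 - (1 - z)) / (1 - z)) * (0 - 1) +
        (inverse z * Ln (1 - z) + inverse (1 - z) * (0 - 1) * Ln z)) (at z)"
      unfolding f_def
      by (intro derivative_intros Li2_has_field_derivative
            DERIV_chain2[where f = Li2] DERIV_chain2[where f = Ln] has_field_derivative_Ln)
         (use z nz in auto)
    moreover have "- Ln (1 - z) / z + (- Ln (1 - (1 - z)) / (1 - z)) * (0 - 1) +
        (inverse z * Ln (1 - z) + inverse (1 - z) * (0 - 1) * Ln z) = 0"
      using nz by (simp add: field_simps)
    ultimately show "(f has_field_derivative 0) (at z within ?S)"
      by (simp add: has_field_derivative_at_within)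
  qed (simp add: convex_Int)
  then obtain k where k: "f z = k" if "z \<in> ?S" for z by blast
  define s where "s n = 1 / (real n + 2)" for n
  have s: "0 < s n" "s n < 1" for n by (auto simp: s_def)
  have norm_1s: "norm (1 - complex_of_real (s n)) = 1 - s n" for n
    using s[of n] norm_of_real[of "1 - s n", where 'a = complex] by simp
  have s0: "s \<longlonglongrightarrow> 0" unfolding s_def by real_asymp
  have "(\<lambda>n. f (of_real (s n))) \<longlonglongrightarrow> Li2 0 + Li2 1 + of_real 0"
  proof -
    have "(\<lambda>n. ln (s n) * ln (1 - s n)) \<longlonglongrightarrow> 0" unfolding s_def by real_asymp
    then have "(\<lambda>n. complex_of_real (ln (s n) * ln (1 - s n))) \<longlonglongrightarrow> of_real 0"
      by (rule tendsto_of_real)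
    moreover have "complex_of_real (ln (s n) * ln (1 - s n)) = Ln (of_real (s n)) * Ln (1 - of_real (s n))" for n
      using s[of n] Ln_of_real[of "s n"] Ln_of_real[of "1 - s n"] by simp
    moreover have "(\<lambda>n. Li2 (of_real (s n))) \<longlonglongrightarrow> Li2 0"
      by (rule continuous_on_tendsto_compose[OF continuous_on_Li2])
         (use s s0 in \<open>auto intro!: always_eventually tendsto_eq_intros simp: abs_less_iff less_imp_le\<close>)
    moreover have "(\<lambda>n. Li2 (1 - of_real (s n))) \<longlonglongrightarrow> Li2 1"
    proof (rule continuous_on_tendsto_compose[OF continuous_on_Li2])
      show "\<forall>\<^sub>F n in sequentially. 1 - complex_of_real (s n) \<in> cball 0 1"
        using s norm_1s by (intro always_eventually) (auto simp: less_imp_le)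
    qed (use s0 in \<open>auto intro!: tendsto_eq_intros\<close>)
    ultimately show ?thesis unfolding f_def by (intro tendsto_add) auto
  qed
  moreover have "f (of_real (s n)) = k" for n
    using s[of n] norm_1s[of n] by (intro k) (simp add: dist_norm)
  ultimately have "k = of_real (pi\<^sup>2 / 6)"
    using LIMSEQ_unique by (simp add: Li2_1 LIMSEQ_const_iff)
  moreover have "f w = k" using assms by (intro k) (auto simp: dist_norm)
  ultimately show ?thesis by (simp add: f_def)
qed

text \<open>Filling the removable singularity with 1 makes the integrand continuous on the whole
  segment, hence integrable in \<open>Li2_has_integral\<close>.\<close>

lemma isCont_Ln_one_minus_div:
  fixes u :: complex
  assumes "1 - u \<notin> \<real>\<^sub>\<le>\<^sub>0"
  shows "isCont (\<lambda>u. if u = 0 then 1 else - Ln (1 - u) / u) u"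
proof (cases "u = 0")
  case True
  have "((\<lambda>u. - Ln (1 - u)) has_field_derivative 1) (at 0)"
    by (auto intro!: derivative_eq_intros)
  then have "(\<lambda>u. - Ln (1 - u) / u) \<midarrow>0\<rightarrow> 1"
    by (simp add: DERIV_def)
  then show ?thesis
    unfolding isCont_def True
    by (subst LIM_equal[where g = "\<lambda>u. - Ln (1 - u) / u"]) auto
next
  case False
  have "isCont (\<lambda>u. - Ln (1 - u) / u) u"
    using assms False by (intro continuous_intros) auto
  moreover have "\<forall>\<^sub>F x in nhds u. - Ln (1 - x) / x = (if x = 0 then 1 else - Ln (1 - x) / x)"
    using t1_space_nhds[OF False] by (rule eventually_mono) auto
  ultimately show ?thesis
    by (subst (asm) isCont_cong) auto
qed

text \<open>Substituting \<open>u = t * z\<close> cancels the factor \<open>z\<close>. Unlike the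
  series, this form covers every point off the cut, so it can exclude zeros outside the unit
  disc.\<close>

lemma Li2_has_integral:
  assumes "z \<notin> of_real ` {1..}"
  shows "((\<lambda>t. - Ln (1 - of_real t * z) / of_real t) has_integral Li2 z) {0..1}"
proof (cases "z = 0")
  case False
  define h where "h u = (if u = 0 then 1 else - Ln (1 - u) / u)" for u :: complex
  \<comment> \<open>The complement of the cut is star-shaped about 0, so the segment stays where
    \<open>Ln (1 - u)\<close> is continuous.\<close>
  have nr: "1 - of_real t * z \<notin> \<real>\<^sub>\<le>\<^sub>0" if "t \<in> {0..1}" for t :: real
  proof
    assume "1 - of_real t * z \<in> \<real>\<^sub>\<le>\<^sub>0"
    then have *: "t * Im z = 0" "1 \<le> t * Re z" by (auto simp: complex_nonpos_Reals_iff)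
    then have "0 < t" "Im z = 0" using that by (auto simp: less_le)
    moreover have "1 \<le> Re z"
    proof (rule ccontr)
      assume "\<not> 1 \<le> Re z"
      then have "t * Re z < t * 1" using \<open>0 < t\<close> by (intro mult_strict_left_mono) auto
      then show False using * that by auto
    qed
    ultimately show False using assms by (metis atLeast_iff complex_is_Real_iff image_eqI of_real_Re)
  qed
  have "continuous_on {0..1} (\<lambda>t. z * h (of_real t * z))"
  proof (intro continuous_on_mult_left continuous_at_imp_continuous_on ballI)
    fix t :: real assume "t \<in> {0..1}"
    then have "isCont h (of_real t * z)"
      unfolding h_def by (intro isCont_Ln_one_minus_div nr)
    then show "isCont (\<lambda>t. h (of_real t * z)) t"
      by (rule isCont_o2[rotated]) (auto intro!: continuous_intros)
  qed
  then obtain y where "((\<lambda>t. z * h (of_real t * z)) has_integral y) {0..1}"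
    using integrable_continuous_real by blast
  \<comment> \<open>At \<open>t = 0\<close> the integrand has the default value 0, its continuous
    version the value \<open>z\<close>; one point does not change the integral.\<close>
  then have y: "((\<lambda>t. - Ln (1 - of_real t * z) / of_real t) has_integral y) {0..1}"
    by (rule has_integral_spike_finite[of "{0}", rotated 2]) (use False in \<open>auto simp: h_def\<close>)
  have "((\<lambda>t. Ln (1 - of_real t * z) / of_real t) has_integral - y) {0..1}"
    using has_integral_neg[OF y] by simp
  then have "((\<lambda>u. Ln (1 - u) / u) has_contour_integral - y) (linepath 0 z)"
    unfolding has_contour_integral_linepath
    using False by (simp add: linepath_def scaleR_conv_of_real)
  with y show ?thesis by (simp add: Li2_def contour_integral_unique)
qed simp

section \<open>Elementary bounds for the dilogarithm off the cut\<close>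

lemma Re_Li2_ge:
  assumes "z \<notin> of_real ` {1..}"
    and "\<And>t. 0 < t \<Longrightarrow> t < 1 \<Longrightarrow> k * t \<le> - Re (Ln (1 - of_real t * z))"
  shows "k \<le> Re (Li2 z)"
proof (rule has_integral_le)
  show "((\<lambda>t. k) has_integral k) {0<..<1::real}"
    using has_integral_const_real[of k 0 1] by (simp add: has_integral_Icc_iff_Ioo)
  show "((\<lambda>t. - Re (Ln (1 - of_real t * z)) / t) has_integral Re (Li2 z)) {0<..<1}"
    using has_integral_linear[OF Li2_has_integral[OF assms(1)] bounded_linear_Re]
    by (simp add: o_def has_integral_Icc_iff_Ioo)
qed (use assms(2) in \<open>simp add: field_simps\<close>)

lemma Im_Li2_has_integral:
  assumes "z \<notin> of_real ` {1..}"
  shows "((\<lambda>t. - Im (Ln (1 - of_real t * z)) / t) has_integral Im (Li2 z)) {0<..<1}"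
  using has_integral_linear[OF Li2_has_integral[OF assms] bounded_linear_Im]
  by (simp add: o_def has_integral_Icc_iff_Ioo)

lemma sin_Im_Ln:
  assumes "z \<noteq> 0"
  shows "sin (Im (Ln z)) = Im z / norm z"
proof -
  have "Im z = Im (exp (Ln z))" using assms by simp
  also have "\<dots> = norm z * sin (Im (Ln z))" using assms by (simp only: Im_exp Re_Ln) simp
  finally show ?thesis using assms by simp
qed

lemma cos_Im_Ln:
  assumes "z \<noteq> 0"
  shows "cos (Im (Ln z)) = Re z / norm z"
proof -
  have "Re z = Re (exp (Ln z))" using assms by simp
  also have "\<dots> = norm z * cos (Im (Ln z))" using assms by (simp only: Re_exp Re_Ln) simp
  finally show ?thesis using assms by simp
qed

lemma notin_slit: "Im z \<noteq> 0 \<Longrightarrow> z \<notin> of_real ` {1..}"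
  by auto

text \<open>The angle \<open>- Im (Ln u)\<close> at \<open>u = 1 - t * z\<close> is at least its
  sine \<open>t * Im z / norm u\<close>, and \<open>norm u\<close> is at most
  \<open>1 + norm z\<close>.\<close>

lemma Im_Li2_ge:
  assumes "Im z > 0"
  shows "Im z / (1 + norm z) \<le> Im (Li2 z)"
proof (rule has_integral_le)
  show "((\<lambda>t. Im z / (1 + norm z)) has_integral Im z / (1 + norm z)) {0<..<1::real}"
    using has_integral_const_real[of "Im z / (1 + norm z)" 0 1] by (simp add: has_integral_Icc_iff_Ioo)
  show "((\<lambda>t. - Im (Ln (1 - of_real t * z)) / t) has_integral Im (Li2 z)) {0<..<1}"
    using assms by (intro Im_Li2_has_integral notin_slit) auto
next
  fix t :: real assume t: "t \<in> {0<..<1}"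
  define u where "u = 1 - of_real t * z"
  have Im_u: "Im u = - (t * Im z)" by (simp add: u_def)
  then have Im_u_neg: "Im u < 0" using t assms by simp
  then have [simp]: "u \<noteq> 0" by auto
  have "norm u \<le> 1 + t * norm z"
    unfolding u_def using t norm_triangle_ineq4[of 1 "of_real t * z"] by (simp add: norm_mult)
  also have "\<dots> \<le> 1 + 1 * norm z"
    using t by (intro add_left_mono mult_right_mono) auto
  finally have le: "norm u \<le> 1 + norm z" by simp
  have "0 < (1 + norm z) * norm u" by (intro mult_pos_pos add_pos_nonneg) auto
  have "Im z / (1 + norm z) \<le> Im z / norm u"
    using le assms \<open>0 < (1 + norm z) * norm u\<close> by (intro divide_left_mono) auto
  also have "\<dots> = sin (- Im (Ln u)) / t"
    using t by (simp add: sin_Im_Ln Im_u)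
  also have "\<dots> \<le> - Im (Ln u) / t"
    using t Im_u_neg Im_Ln_pos_le[of u] Im_Ln_le_pi[of u]
    by (intro divide_right_mono sin_x_le_x) auto
  finally show "Im z / (1 + norm z) \<le> - Im (Ln (1 - of_real t * z)) / t"
    by (simp add: u_def)
qed

text \<open>Mirror image of \<open>Im_Li2_ge\<close>. Since a zero satisfies
  \<open>Im (Li2 w) = 2 * pi * ln (norm w)\<close>, the two signs put zeros in the upper half-plane
  outside the unit disc and zeros in the lower half-plane inside it.\<close>

lemma Im_Li2_le:
  assumes "Im z < 0"
  shows "Im (Li2 z) \<le> Im z / (1 + norm z)"
proof (rule has_integral_le)
  show "((\<lambda>t. Im z / (1 + norm z)) has_integral Im z / (1 + norm z)) {0<..<1::real}"
    using has_integral_const_real[of "Im z / (1 + norm z)" 0 1] by (simp add: has_integral_Icc_iff_Ioo)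
  show "((\<lambda>t. - Im (Ln (1 - of_real t * z)) / t) has_integral Im (Li2 z)) {0<..<1}"
    using assms by (intro Im_Li2_has_integral notin_slit) auto
next
  fix t :: real assume t: "t \<in> {0<..<1}"
  define u where "u = 1 - of_real t * z"
  have Im_u: "Im u = - (t * Im z)" by (simp add: u_def)
  then have Im_u_pos: "Im u > 0" using t assms by (simp add: mult_pos_neg)
  then have [simp]: "u \<noteq> 0" by auto
  have "norm u \<le> 1 + t * norm z"
    unfolding u_def using t norm_triangle_ineq4[of 1 "of_real t * z"] by (simp add: norm_mult)
  also have "\<dots> \<le> 1 + 1 * norm z"
    using t by (intro add_left_mono mult_right_mono) auto
  finally have le: "norm u \<le> 1 + norm z" by simp
  have "0 < (1 + norm z) * norm u" by (intro mult_pos_pos add_pos_nonneg) auto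
  have "- Im (Ln u) / t \<le> - sin (Im (Ln u)) / t"
    using t Im_u_pos Im_Ln_pos_lt[of u]
    by (intro divide_right_mono) (auto intro!: sin_x_le_x)
  also have "\<dots> = Im z / norm u"
    using t by (simp add: sin_Im_Ln Im_u)
  also have "\<dots> \<le> Im z / (1 + norm z)"
    using le assms \<open>0 < (1 + norm z) * norm u\<close>
    by (intro divide_left_mono_neg) (auto simp: mult.commute)
  finally show "- Im (Ln (1 - of_real t * z)) / t \<le> Im z / (1 + norm z)"
    by (simp add: u_def)
qed

text \<open>Half-angle form of \<open>x <= tan x\<close>. It bounds an angle through its sine and
  cosine, which are explicit quotients for the argument of a given complex number.\<close>

lemma le_2_tan_half:
  fixes x :: real
  assumes "0 \<le> x" "x \<le> pi / 2"
  shows "x \<le> 2 * (sin x / (cos x + 1))"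
proof -
  have "x / 2 \<le> tan (x / 2)"
    using abs_tan_ge[of "x / 2"] assms tan_pos_pi2_le[of "x / 2"] pi_gt_zero by auto
  also have "\<dots> = sin x / (cos x + 1)" by (simp add: tan_half)
  finally show ?thesis by linarith
qed

lemma le_2_sin:
  fixes x :: real
  assumes "0 \<le> x" "x \<le> pi / 2"
  shows "x \<le> 2 * sin x"
proof -
  have "sin x / (cos x + 1) \<le> sin x / 1"
    using assms cos_ge_zero[of x] sin_ge_zero[of x] by (intro divide_left_mono) auto
  then show ?thesis using le_2_tan_half[OF assms] by linarith
qed

text \<open>For \<open>q\<close> in the unit disc, \<open>1 - q\<close> lies in the closed right
  half-plane, so the angle is at most \<open>pi / 2\<close> and hence at most twice its sine
  \<open>Im q / norm (1 - q)\<close>. The denominator cancels because \<open>Im q\<close> is the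
  imaginary part of \<open>q * cnj (1 - q)\<close>.\<close>

lemma neg_Im_Ln_one_minus_le:
  assumes "norm q \<le> 1" "Im q > 0"
  shows "- Im (Ln (1 - q)) \<le> 2 * norm q"
proof -
  have nz: "1 - q \<noteq> 0" using assms(2) by auto
  have le: "Im q \<le> norm q * norm (1 - q)"
  proof -
    have "Im q = Im (q * cnj (1 - q))" by (simp add: algebra_simps)
    also have "\<dots> \<le> norm (q * cnj (1 - q))" using abs_Im_le_cmod[of "q * cnj (1 - q)"] by linarith
    also have "\<dots> = norm q * norm (1 - q)" by (simp only: norm_mult complex_mod_cnj)
    finally show ?thesis .
  qed
  have "Re (1 - q) \<ge> 0" using assms(1) complex_Re_le_cmod[of q] by auto
  then have "\<bar>Im (Ln (1 - q))\<bar> \<le> pi / 2" using Re_Ln_pos_le[of "1 - q"] nz by auto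
  moreover have "Im (Ln (1 - q)) < 0"
    using Im_Ln_pos_le[of "1 - q"] Im_Ln_le_pi[of "1 - q"] nz assms(2) by auto
  ultimately have "- Im (Ln (1 - q)) \<le> 2 * sin (- Im (Ln (1 - q)))"
    by (intro le_2_sin) auto
  also have "\<dots> = 2 * (Im q / norm (1 - q))"
    using nz by (simp add: sin_Im_Ln)
  also have "\<dots> \<le> 2 * norm q"
    using le nz by (intro mult_left_mono) (auto simp: divide_le_eq)
  finally show ?thesis .
qed

text \<open>The integral is split at \<open>t = 1 / norm z\<close>, where \<open>t * z\<close>
  leaves the unit disc. Below, the linear bound on the angle contributes 2; above, the bound
  \<open>pi\<close> contributes \<open>pi * ln (norm z)\<close>. This factor \<open>pi\<close> is
  half the \<open>2 * pi\<close> of the zero equation, so the modulus of a zero becomes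
  bounded.\<close>

lemma Im_Li2_le_ln:
  assumes "Im z > 0" "norm z \<ge> 1"
  shows "Im (Li2 z) \<le> 2 + pi * ln (norm z)"
proof (rule has_integral_le)
  let ?r = "norm z"
  define g where "g t = (if t \<le> 1 / ?r then 2 * ?r else pi / t)" for t
  have r: "0 < 1 / ?r" "1 / ?r \<le> 1" using assms by (auto simp: divide_le_eq)
  have pos: "0 < t" if "1 / ?r \<le> t" for t using r(1) that by linarith
  have "(g has_integral 2 * ?r * (1 / ?r)) {0..1 / ?r}"
    using r has_integral_const_real[of "2 * ?r" 0 "1 / ?r"]
    by (subst has_integral_cong[of _ g "\<lambda>t. 2 * ?r"]) (auto simp: g_def mult.commute)
  moreover have "((\<lambda>t. pi / t) has_integral (pi * ln 1 - pi * ln (1 / ?r))) {1 / ?r..1}"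
    using r pos
    by (intro fundamental_theorem_of_calculus)
       (auto intro!: derivative_eq_intros simp flip: has_real_derivative_iff_has_vector_derivative)
  then have "(g has_integral (pi * ln 1 - pi * ln (1 / ?r))) {1 / ?r..1}"
    by (rule has_integral_spike_finite[of "{1 / ?r}", rotated 2]) (auto simp: g_def)
  ultimately have "(g has_integral (2 * ?r * (1 / ?r) + (pi * ln 1 - pi * ln (1 / ?r)))) {0..1}"
    using r by (intro has_integral_combine) auto
  also have "2 * ?r * (1 / ?r) + (pi * ln 1 - pi * ln (1 / ?r)) = 2 + pi * ln ?r"
    using assms by (auto simp: ln_div)
  finally show "(g has_integral 2 + pi * ln ?r) {0<..<1}"
    by (simp add: has_integral_Icc_iff_Ioo)
  show "((\<lambda>t. - Im (Ln (1 - of_real t * z)) / t) has_integral Im (Li2 z)) {0<..<1}"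
    using assms by (intro Im_Li2_has_integral notin_slit) auto
  fix t :: real assume t: "t \<in> {0<..<1}"
  show "- Im (Ln (1 - of_real t * z)) / t \<le> g t"
  proof (cases "t \<le> 1 / ?r")
    case True
    then have "norm (of_real t * z) \<le> 1"
      using t r by (simp add: norm_mult field_simps split: if_splits)
    then have "- Im (Ln (1 - of_real t * z)) \<le> 2 * norm (of_real t * z)"
      using t assms by (intro neg_Im_Ln_one_minus_le) auto
    then show ?thesis using t True by (simp add: g_def norm_mult field_simps)
  next
    case False
    have "1 - of_real t * z \<noteq> 0" using assms t by (auto simp: complex_eq_iff)
    then have "- Im (Ln (1 - of_real t * z)) / t \<le> pi / t"
      using t mpi_less_Im_Ln[of "1 - of_real t * z"] by (intro divide_right_mono) auto
    then show ?thesis using False by (simp add: g_def)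
  qed
qed

lemma cos_ge_quadratic: "1 - x\<^sup>2 / 2 \<le> cos x" for x :: real
proof -
  have "\<bar>sin (x / 2)\<bar>\<^sup>2 \<le> \<bar>x / 2\<bar>\<^sup>2"
    by (intro power_mono abs_sin_x_le_abs_x) auto
  then show ?thesis using cos_double_sin[of "x / 2"] by (simp add: power_divide)
qed

lemma Re_Li2_of_real_ge:
  fixes x :: real
  assumes "x < 1"
  shows "x \<le> Re (Li2 (of_real x))"
proof (rule Re_Li2_ge)
  fix t :: real assume t: "0 < t" "t < 1"
  have pos: "0 < 1 - t * x"
  proof (cases "x \<le> 0")
    case True
    then have "t * x \<le> 0" using t by (simp add: mult_nonneg_nonpos)
    then show ?thesis by simp
  next
    case False
    then have "t * x < 1 * 1" using t assms by (intro mult_strict_mono) auto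
    then show ?thesis by simp
  qed
  then have "ln (1 - t * x) \<le> - (x * t)" using ln_le_minus_one[OF pos] by (simp add: mult.commute)
  moreover have "Ln (1 - of_real t * of_real x) = of_real (ln (1 - t * x))"
    using Ln_of_real[OF pos] by simp
  ultimately show "x * t \<le> - Re (Ln (1 - of_real t * of_real x))" by simp
qed (use assms in auto)

lemma Re_Li2_ge_neg_norm:
  assumes "Im z \<noteq> 0"
  shows "- norm z \<le> Re (Li2 z)"
proof (rule Re_Li2_ge)
  fix t :: real assume t: "0 < t" "t < 1"
  have nz: "1 - of_real t * z \<noteq> 0" using assms t by (auto simp: complex_eq_iff)
  have "ln (norm (1 - of_real t * z)) \<le> norm (1 - of_real t * z) - 1"
    using nz by (intro ln_le_minus_one) auto
  also have "\<dots> \<le> norm z * t"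
    using norm_triangle_ineq4[of 1 "of_real t * z"] t by (simp add: norm_mult mult.commute)
  finally show "- norm z * t \<le> - Re (Ln (1 - of_real t * z))" using nz by simp
qed (rule notin_slit[OF assms])

text \<open>The second hypothesis puts \<open>z\<close> in the closed disc of radius 1 about 1. That
  disc contains 0, hence every \<open>t * z\<close>, and so \<open>ln (norm (1 - t * z))\<close> is
  nonpositive.\<close>

lemma Re_Li2_nonneg:
  assumes "Im z \<noteq> 0" "(norm z)\<^sup>2 \<le> 2 * Re z"
  shows "0 \<le> Re (Li2 z)"
proof (rule Re_Li2_ge)
  fix t :: real assume t: "0 < t" "t < 1"
  have nz: "1 - of_real t * z \<noteq> 0" using assms t by (auto simp: complex_eq_iff)
  have "(norm (1 - of_real t * z))\<^sup>2 = 1 - t * (2 * Re z - t * (norm z)\<^sup>2)"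
    by (simp add: cmod_power2) (simp add: power2_eq_square algebra_simps)
  also have "\<dots> \<le> 1"
  proof -
    have "t * (norm z)\<^sup>2 \<le> 1 * (norm z)\<^sup>2" using t by (intro mult_right_mono) auto
    then show ?thesis using assms t by simp
  qed
  finally have "norm (1 - of_real t * z) \<le> 1" by (simp add: power_le_one_iff)
  then show "0 * t \<le> - Re (Ln (1 - of_real t * z))" using nz by simp
qed (rule notin_slit[OF assms(1)])

section \<open>Existence and uniqueness of the zero\<close>

abbreviation slit_plane :: "complex set" where
  "slit_plane \<equiv> - (complex_of_real ` ({..0} \<union> {1..}))"

lemma dilog_zero_Re_Im:
  assumes "Li2 w = 2 * pi * \<i> * Ln w" "w \<noteq> 0"
  shows "Re (Li2 w) = - 2 * pi * Im (Ln w)" "Im (Li2 w) = 2 * pi * ln (norm w)"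
  using assms by auto

lemma exp_1_ge: "2718 / 1000 \<le> exp (1::real)"
  using e_approx_32 unfolding abs_diff_le_iff by simp

text \<open>Bracketing e between 2.718 and 2.72 reduces a logarithm bound \<open>m / n\<close> to a
  comparison of powers of rationals; \<open>ln_le_ratio\<close> is the counterpart from
  above.\<close>

lemma ratio_le_ln:
  fixes y :: real
  assumes "0 < y" "0 < n" "(272 / 100) ^ m \<le> y ^ n"
  shows "real m / real n \<le> ln y"
proof -
  have "real m * 1 \<le> real m * ln (272 / 100)"
    using e_less_272 by (intro mult_left_mono) (auto simp: ln_ge_iff)
  also have "\<dots> = ln ((272 / 100) ^ m)" by (simp add: ln_realpow)
  also have "\<dots> \<le> ln (y ^ n)" using assms by simp
  also have "\<dots> = real n * ln y" using assms by (simp add: ln_realpow)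
  finally show ?thesis using assms by (simp add: field_simps)
qed

lemma ln_le_ratio:
  fixes y :: real
  assumes "0 < y" "0 < n" "y ^ n \<le> (2718 / 1000) ^ m"
  shows "ln y \<le> real m / real n"
proof -
  have "real n * ln y = ln (y ^ n)" using assms by (simp add: ln_realpow)
  also have "\<dots> \<le> ln ((2718 / 1000) ^ m)" using assms by simp
  also have "\<dots> = real m * ln (2718 / 1000)" by (simp add: ln_realpow)
  also have "\<dots> \<le> real m * ln (exp 1)"
    using exp_1_ge by (intro mult_left_mono ln_mono) auto
  finally show ?thesis using assms by (simp add: field_simps)
qed

lemma dilog_zero_lower_half_disc:
  assumes "w \<in> slit_plane" and eq: "Li2 w = 2 * pi * \<i> * Ln w"
  shows "Im w < 0" "norm w < 1"
proof -
  have nz: "w \<noteq> 0" using assms by force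
  note zero = dilog_zero_Re_Im[OF eq nz]
  have "Im w \<noteq> 0"
  proof
    assume "Im w = 0"
    then have w: "w = of_real (Re w)" by (simp add: complex_eq_iff)
    with assms(1) have "0 < Re w" "Re w < 1"
      by (metis ComplD UnCI atLeast_iff atMost_iff image_eqI linorder_not_less)+
    then have "Im (Ln w) = 0" by (metis Im_Ln_of_real w)
    moreover have "Re w \<le> Re (Li2 w)" using Re_Li2_of_real_ge[OF \<open>Re w < 1\<close>] w by simp
    ultimately show False using zero(1) \<open>0 < Re w\<close> by simp
  qed
  moreover have "\<not> Im w > 0"
  proof
    assume pos: "Im w > 0"
    \<comment> \<open>The imaginary part of the equation gives \<open>norm w <= 1.9\<close>, the
      real part then \<open>\<phi> <= 1.9 / (2 * pi) < 0.307\<close>. So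
      \<open>2 * cos \<phi> >= 1.904\<close>, which puts \<open>w\<close> in the disc of
      \<open>Re_Li2_nonneg\<close>, although \<open>Re (Li2 w) = - 2 * pi * \<phi>\<close> is
      negative.\<close>
    define \<phi> where "\<phi> = Im (Ln w)"
    have phi: "0 < \<phi>" using Im_Ln_pos_lt_imp[OF pos] by (simp add: \<phi>_def)
    have "0 < Im w / (1 + norm w)" using pos by (intro divide_pos_pos add_pos_nonneg) auto
    then have "0 < 2 * pi * ln (norm w)" using Im_Li2_ge[OF pos] zero(2) by linarith
    then have gt1: "norm w > 1" using nz by (simp add: zero_less_mult_iff)
    have "2 * pi * ln (norm w) \<le> 2 + pi * ln (norm w)"
      using Im_Li2_le_ln[OF pos] gt1 zero(2) by simp
    then have "pi * ln (norm w) \<le> 2" by simp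
    also have "2 \<le> pi * (64 / 100)" using pi_approx by simp
    finally have "ln (norm w) \<le> 64 / 100" by simp
    also have "64 / 100 \<le> ln (19 / 10 :: real)"
      using ratio_le_ln[of "19 / 10" 25 16] by (simp add: power_divide)
    finally have le: "norm w \<le> 19 / 10" using nz by simp
    have "2 * pi * \<phi> \<le> norm w"
      using Re_Li2_ge_neg_norm[of w] pos zero(1) by (simp add: \<phi>_def)
    then have "2 * pi * \<phi> \<le> 19 / 10" using le by linarith
    moreover have "(62 / 10) * \<phi> \<le> 2 * pi * \<phi>"
      using phi pi_approx by (intro mult_right_mono) auto
    ultimately have "\<phi> \<le> 307 / 1000" by simp
    then have "\<phi>\<^sup>2 \<le> (307 / 1000)\<^sup>2" using phi by (intro power_mono) auto
    then have "cos \<phi> \<ge> (952 / 1000)" using cos_ge_quadratic[of \<phi>] by (simp add: power2_eq_square)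
    then have "norm w \<le> 2 * cos \<phi>" using le by simp
    then have "norm w * norm w \<le> norm w * (2 * cos \<phi>)" by (intro mult_left_mono) auto
    moreover have "Re w = norm w * cos \<phi>"
      using nz by (simp add: \<phi>_def cos_Im_Ln)
    ultimately have "0 \<le> Re (Li2 w)"
      using pos by (intro Re_Li2_nonneg) (auto simp: power2_eq_square)
    then show False using zero(1) phi pi_gt_zero by (simp add: \<phi>_def mult_le_0_iff)
  qed
  ultimately show neg: "Im w < 0" by simp
  have "Im w / (1 + norm w) < 0" using neg by (intro divide_neg_pos add_pos_nonneg) auto
  then have "2 * pi * ln (norm w) < 0" using Im_Li2_le[OF neg] zero(2) by linarith
  then show "norm w < 1" using nz by (simp add: mult_less_0_iff)
qed

section \<open>The fixed point map and its contraction on a box\<close>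

definition dilog_map :: "complex \<Rightarrow> complex" where
  "dilog_map \<zeta> = Li2 (exp \<zeta>) / (2 * pi * \<i>)"

text \<open>The box is cut off from \<open>0\<close>, where the derivative of \<open>dilog_map\<close> blows up like a logarithm,
  and from the imaginary axis, where \<open>exp\<close> reaches the unit circle.\<close>

definition dilog_box :: "complex set" where
  "dilog_box = cbox (Complex (-(27 / 100)) (-(27 / 100))) (Complex (-(2 / 1000)) (-(6 / 100)))"

lemma mem_dilog_box:
  "\<zeta> \<in> dilog_box \<longleftrightarrow> -(27 / 100) \<le> Re \<zeta> \<and> Re \<zeta> \<le> -(2 / 1000) \<and> -(27 / 100) \<le> Im \<zeta> \<and> Im \<zeta> \<le> -(6 / 100)"
  by (auto simp: dilog_box_def in_cbox_complex_iff)

lemma Re_dilog_map: "Re (dilog_map \<zeta>) = Im (Li2 (exp \<zeta>)) / (2 * pi)"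
  and Im_dilog_map: "Im (dilog_map \<zeta>) = - Re (Li2 (exp \<zeta>)) / (2 * pi)"
  by (simp_all add: dilog_map_def Re_divide Im_divide power2_eq_square)

lemma pi_squared_bounds: "pi\<^sup>2 \<le> 98697 / 10000" "98695 / 10000 \<le> pi\<^sup>2"
proof -
  have "pi\<^sup>2 \<le> (31415927 / 10000000)\<^sup>2" using pi_approx by (intro power_mono) auto
  also have "\<dots> \<le> 98697 / 10000" by (simp add: power2_eq_square)
  finally show "pi\<^sup>2 \<le> 98697 / 10000" .
  have "98695 / 10000 \<le> ((3141592 / 1000000)::real)\<^sup>2" by (simp add: power2_eq_square)
  also have "\<dots> \<le> pi\<^sup>2" using pi_approx by (intro power_mono) auto
  finally show "98695 / 10000 \<le> pi\<^sup>2" .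
qed

text \<open>Dividing the bound \<open>pi\<^sup>2 / 6\<close> of \<open>Li2\<close> by
  \<open>2 * pi\<close> gives \<open>pi / 12 < 0.27\<close>, the source of the outer sides of the
  box.\<close>

lemma abs_dilog_map_le:
  assumes "Re \<zeta> \<le> 0"
  shows "\<bar>Re (dilog_map \<zeta>)\<bar> \<le> 27 / 100" "\<bar>Im (dilog_map \<zeta>)\<bar> \<le> 27 / 100"
proof -
  have "norm (Li2 (exp \<zeta>)) \<le> pi\<^sup>2 / 6" using assms by (intro norm_Li2_le) simp
  then have "norm (Li2 (exp \<zeta>)) / (2 * pi) \<le> (pi\<^sup>2 / 6) / (2 * pi)"
    by (intro divide_right_mono) auto
  then have "norm (dilog_map \<zeta>) \<le> (pi\<^sup>2 / 6) / (2 * pi)"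
    by (simp add: dilog_map_def norm_divide norm_mult)
  also have "\<dots> = pi / 12" by (simp add: power2_eq_square)
  also have "\<dots> \<le> 27 / 100" using pi_approx by simp
  finally show "\<bar>Re (dilog_map \<zeta>)\<bar> \<le> 27 / 100" "\<bar>Im (dilog_map \<zeta>)\<bar> \<le> 27 / 100"
    using abs_Re_le_cmod[of "dilog_map \<zeta>"] abs_Im_le_cmod[of "dilog_map \<zeta>"] by linarith+
qed

lemma cos_ge_of_abs_le:
  fixes x y :: real
  assumes "\<bar>x\<bar> \<le> y"
  shows "1 - y\<^sup>2 / 2 \<le> cos x"
proof -
  have "\<bar>x\<bar>\<^sup>2 \<le> y\<^sup>2" using assms by (intro power_mono) auto
  then show ?thesis using cos_ge_quadratic[of x] by simp
qed

text \<open>The terms \<open>w + w\<^sup>2 / 4\<close> have real part at least 0.81, and the rest of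
  the series is below \<open>pi\<^sup>2 / 6 - 5 / 4 < 0.395\<close> even on the unit circle. Hence
  \<open>Re (Li2 w) >= 0.4 > 2 * pi * 0.06\<close>, which gives the upper side of the box.\<close>

lemma Im_dilog_map_le:
  assumes "-(27 / 100) \<le> Re \<zeta>" "Re \<zeta> \<le> 0" "\<bar>Im \<zeta>\<bar> \<le> 27 / 100"
  shows "Im (dilog_map \<zeta>) \<le> -(6 / 100)"
proof -
  define w where "w = exp \<zeta>"
  have exp_ge: "73 / 100 \<le> exp (Re \<zeta>)" using exp_ge_add_one_self[of "Re \<zeta>"] assms by linarith
  have "(73 / 100) * (96 / 100) \<le> exp (Re \<zeta>) * cos (Im \<zeta>)"
    using exp_ge cos_ge_of_abs_le[OF assms(3)] by (intro mult_mono) (auto simp: power2_eq_square)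
  then have 1: "7 / 10 \<le> Re w" by (simp add: w_def Re_exp)
  have w2: "w\<^sup>2 = exp (2 * \<zeta>)" by (simp add: w_def exp_double)
  have "(73 / 100) * (73 / 100) \<le> exp (Re \<zeta>) * exp (Re \<zeta>)" using exp_ge by (intro mult_mono) auto
  also have "\<dots> = exp (2 * Re \<zeta>)" by (simp flip: exp_add)
  finally have "(73 / 100) * (73 / 100) \<le> exp (2 * Re \<zeta>)" .
  moreover have "\<bar>2 * Im \<zeta>\<bar> \<le> 54 / 100" using assms(3) by simp
  ultimately have "(73 / 100) * (73 / 100) * (85 / 100) \<le> exp (2 * Re \<zeta>) * cos (2 * Im \<zeta>)"
    using cos_ge_of_abs_le[of "2 * Im \<zeta>" "54 / 100"]
    by (intro mult_mono) (auto simp: power2_eq_square)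
  then have 2: "45 / 100 \<le> Re (w\<^sup>2)" by (simp add: w2 Re_exp)
  have "norm w \<le> 1" using assms by (simp add: w_def)
  from norm_Li2_minus_partial_sum_le[OF this, of 3]
  have "norm (Li2 w - (w + w\<^sup>2 / 4)) \<le> pi\<^sup>2 / 6 - 5 / 4"
    by (simp add: eval_nat_numeral)
  then have "\<bar>Re (Li2 w - (w + w\<^sup>2 / 4))\<bar> \<le> 395 / 1000"
    using abs_Re_le_cmod[of "Li2 w - (w + w\<^sup>2 / 4)"] pi_squared_bounds by linarith
  moreover have "Re (Li2 w - (w + w\<^sup>2 / 4)) = Re (Li2 w) - Re w - Re (w\<^sup>2) / 4" by simp
  ultimately have "4 / 10 \<le> Re (Li2 w)" using 1 2 by linarith
  moreover have "2 * pi * (6 / 100) \<le> 4 / 10" using pi_approx by simp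
  ultimately have "2 * pi * (6 / 100) \<le> Re (Li2 w)" by linarith
  then show ?thesis by (simp add: Im_dilog_map w_def field_simps)
qed

lemma x_cos_le_sin:
  fixes x :: real
  assumes "0 \<le> x" "x < pi / 2"
  shows "x * cos x \<le> sin x"
proof -
  have "cos x > 0" using assms by (intro cos_gt_zero_pi) auto
  moreover have "x \<le> tan x" using abs_tan_ge[of x] assms tan_pos_pi2_le[of x] by auto
  ultimately show ?thesis by (simp add: tan_def field_simps)
qed

text \<open>The distance of \<open>exp \<zeta>\<close> from the real axis makes the imaginary part
  of its dilogarithm negative by a definite amount and keeps \<open>1 - exp \<zeta>\<close> away
  from the singularity of the logarithm.\<close>

lemma Im_exp_le:
  assumes "-(27 / 100) \<le> Re \<zeta>" "-(27 / 100) \<le> Im \<zeta>" "Im \<zeta> \<le> -(6 / 100)"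
  shows "Im (exp \<zeta>) \<le> -(42 / 1000)"
proof -
  define y where "y = - Im \<zeta>"
  have y: "6 / 100 \<le> y" "y \<le> 27 / 100" using assms by (auto simp: y_def)
  have "(6 / 100) * (96 / 100) \<le> y * cos y"
    using y cos_ge_of_abs_le[of y "27 / 100"] by (intro mult_mono) (auto simp: power2_eq_square)
  also have "\<dots> \<le> sin y" using y pi_approx by (intro x_cos_le_sin) auto
  finally have "(6 / 100) * (96 / 100) \<le> sin y" .
  moreover have "73 / 100 \<le> exp (Re \<zeta>)"
    using exp_ge_add_one_self[of "Re \<zeta>"] assms by linarith
  ultimately have "(73 / 100) * ((6 / 100) * (96 / 100)) \<le> exp (Re \<zeta>) * sin y"
    by (intro mult_mono) auto
  then show ?thesis by (simp add: Im_exp y_def)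
qed

text \<open>The region of the hypotheses reaches up to the imaginary axis. Besides the self-map
  property this allows placing an arbitrary zero, for which only a nonpositive real part of
  \<open>Ln w\<close> is known at first. The right side of the box comes from
  \<open>0.042 / 2 > 2 * pi * 0.002\<close>.\<close>

lemma dilog_map_in_box:
  assumes "-(27 / 100) \<le> Re \<zeta>" "Re \<zeta> \<le> 0" "-(27 / 100) \<le> Im \<zeta>" "Im \<zeta> \<le> -(6 / 100)"
  shows "dilog_map \<zeta> \<in> dilog_box"
proof -
  have Im: "Im (exp \<zeta>) \<le> -(42 / 1000)" using assms by (intro Im_exp_le)
  have "norm (exp \<zeta>) \<le> 1" using assms by simp
  then have "Im (exp \<zeta>) / (1 + norm (exp \<zeta>)) \<le> Im (exp \<zeta>) / 2"
    using Im by (intro divide_left_mono_neg mult_pos_pos add_pos_pos) auto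
  moreover have "Im (Li2 (exp \<zeta>)) \<le> Im (exp \<zeta>) / (1 + norm (exp \<zeta>))" using Im by (intro Im_Li2_le) auto
  ultimately have "Im (Li2 (exp \<zeta>)) \<le> -(21 / 1000)" using Im by linarith
  moreover have "2 * pi * (2 / 1000) \<le> 21 / 1000" using pi_approx by simp
  ultimately have "Im (Li2 (exp \<zeta>)) \<le> - (2 * pi * (2 / 1000))" by linarith
  then have "Re (dilog_map \<zeta>) \<le> -(2 / 1000)" by (simp add: Re_dilog_map field_simps)
  moreover have "Im (dilog_map \<zeta>) \<le> -(6 / 100)" using assms by (intro Im_dilog_map_le) auto
  ultimately show ?thesis
    using abs_dilog_map_le[OF assms(2)] by (auto simp: mem_dilog_box)
qed

text \<open>The derivative is \<open>- Ln (1 - w) / (2 * pi * \<i>)\<close>, where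
  \<open>0.042 <= norm (1 - w) <= 2\<close> and \<open>1 - w\<close> lies in the right half-plane.
  So the logarithm has squared modulus at most \<open>3.4\<^sup>2 + (pi / 2)\<^sup>2\<close>, below
  the square of \<open>0.6 * 2 * pi\<close>.\<close>

lemma dilog_map_contraction:
  assumes "a \<in> dilog_box" "b \<in> dilog_box"
  shows "norm (dilog_map a - dilog_map b) \<le> (6 / 10) * norm (a - b)"
proof (rule field_differentiable_bound[OF _ _ _ assms])
  show "convex dilog_box" by (simp add: dilog_box_def)
next
  fix \<zeta> assume z: "\<zeta> \<in> dilog_box"
  define w where "w = exp \<zeta>"
  have w: "norm w < 1" "w \<noteq> 0" using z by (auto simp: w_def mem_dilog_box)
  have "((\<lambda>\<zeta>. Li2 (exp \<zeta>)) has_field_derivative (- Ln (1 - w) / w * exp \<zeta>)) (at \<zeta>)"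
    using w unfolding w_def by (intro DERIV_chain2[where f = Li2] Li2_has_field_derivative DERIV_exp)
  then have "(dilog_map has_field_derivative (- Ln (1 - w) / w * exp \<zeta>) / (2 * pi * \<i>)) (at \<zeta>)"
    unfolding dilog_map_def by (rule DERIV_cdivide)
  then show "(dilog_map has_field_derivative (- Ln (1 - exp \<zeta>) / (2 * pi * \<i>))) (at \<zeta> within dilog_box)"
    using w by (simp add: w_def has_field_derivative_at_within)
  define u where "u = 1 - w"
  have u0: "u \<noteq> 0" using w by (auto simp: u_def)
  have "Im w \<le> -(42 / 1000)" using z Im_exp_le[of \<zeta>] by (simp add: w_def mem_dilog_box)
  then have norm_u: "42 / 1000 \<le> norm u" using abs_Im_le_cmod[of u] by (simp add: u_def)
  have "ln (1000 / 42) \<le> (17 / 5 :: real)"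
    using ln_le_ratio[of "1000 / 42" 5 17] by (simp add: power_divide)
  then have "- (34 / 10) \<le> ln (42 / 1000 :: real)"
    by (simp add: ln_div)
  also have "\<dots> \<le> ln (norm u)" using norm_u by (intro ln_mono) auto
  finally have "- (34 / 10) \<le> ln (norm u)" .
  moreover have "ln (norm u) \<le> 34 / 10"
    using ln_le_minus_one[of "norm u"] u0 norm_triangle_ineq4[of 1 w] w by (simp add: u_def)
  ultimately have "\<bar>ln (norm u)\<bar> \<le> 34 / 10" by simp
  then have "\<bar>ln (norm u)\<bar>\<^sup>2 \<le> (34 / 10)\<^sup>2" by (intro power_mono) auto
  moreover have "\<bar>Im (Ln u)\<bar> < pi / 2"
    using complex_Re_le_cmod[of w] w by (intro Re_Ln_pos_lt_imp) (auto simp: u_def)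
  then have "\<bar>Im (Ln u)\<bar>\<^sup>2 \<le> (pi / 2)\<^sup>2" by (intro power_mono) auto
  ultimately have "(norm (Ln u))\<^sup>2 \<le> (34 / 10)\<^sup>2 + (pi / 2)\<^sup>2"
    using u0 by (simp add: cmod_power2)
  also have "\<dots> \<le> ((6 / 10) * (2 * pi))\<^sup>2"
    using pi_squared_bounds by (simp add: power_mult_distrib power_divide power2_eq_square[of "_ :: real"])
  finally have "norm (Ln u) \<le> (6 / 10) * (2 * pi)" by (rule power2_le_imp_le) simp
  then show "norm (- Ln (1 - exp \<zeta>) / (2 * pi * \<i>)) \<le> 6 / 10"
    by (simp add: norm_divide norm_mult u_def w_def field_simps)
qed

lemma dilog_map_eq_iff:
  assumes "w \<noteq> 0"
  shows "Li2 w = 2 * pi * \<i> * Ln w \<longleftrightarrow> dilog_map (Ln w) = Ln w"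
  using assms by (simp add: dilog_map_def field_simps)

text \<open>A bootstrap: at a zero, \<open>Ln w\<close> equals its own image, so bounds on values of
  the map are bounds on \<open>Ln w\<close>. The crude bound 0.27 supplies the hypotheses of
  \<open>Im_dilog_map_le\<close>, and both together those of
  \<open>dilog_map_in_box\<close>.\<close>

lemma dilog_zero_in_box:
  assumes "w \<in> slit_plane" "Li2 w = 2 * pi * \<i> * Ln w"
  shows "Ln w \<in> dilog_box" "dilog_map (Ln w) = Ln w"
proof -
  note w = dilog_zero_lower_half_disc[OF assms]
  have nz: "w \<noteq> 0" using w by auto
  show eq: "dilog_map (Ln w) = Ln w" using assms nz dilog_map_eq_iff by blast
  have neg: "Re (Ln w) \<le> 0" using w nz by simp
  note abs = abs_dilog_map_le[OF neg, unfolded eq]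
  have "Im (Ln w) \<le> -(6 / 100)"
    using Im_dilog_map_le[of "Ln w"] abs neg by (simp only: eq abs_le_iff) auto
  then have "dilog_map (Ln w) \<in> dilog_box"
    using abs neg by (intro dilog_map_in_box) (simp_all only: abs_le_iff, auto)
  then show "Ln w \<in> dilog_box" by (simp add: eq)
qed

lemma dilog_zero_unique: "\<exists>!w. w \<in> slit_plane \<and> Li2 w - 2 * pi * \<i> * Ln w = 0"
proof -
  have fix1: "\<exists>!\<zeta>\<in>dilog_box. dilog_map \<zeta> = \<zeta>"
  proof (rule Banach_fix)
    show "complete dilog_box" unfolding dilog_box_def
      by (intro compact_imp_complete compact_cbox)
    have "Complex (-(1 / 10)) (-(1 / 10)) \<in> dilog_box" by (simp add: mem_dilog_box)
    then show "dilog_box \<noteq> {}" by blast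
    show "dilog_map ` dilog_box \<subseteq> dilog_box"
      by (auto intro!: dilog_map_in_box simp: mem_dilog_box)
    show "dist (dilog_map x) (dilog_map y) \<le> (6 / 10) * dist x y" if "x \<in> dilog_box" "y \<in> dilog_box" for x y
      using dilog_map_contraction[OF that] by (simp add: dist_norm)
  qed auto
  then obtain \<zeta> where \<zeta>: "\<zeta> \<in> dilog_box" "dilog_map \<zeta> = \<zeta>" by blast
  \<comment> \<open>Imaginary parts in the box lie strictly between \<open>- pi\<close> and
    \<open>pi\<close>, so \<open>Ln\<close> inverts \<open>exp\<close> there.\<close>
  then have Ln: "Ln (exp \<zeta>) = \<zeta>" using pi_approx by (intro Ln_exp) (auto simp: mem_dilog_box)
  have "Im (exp \<zeta>) < 0" using Im_exp_le[of \<zeta>] \<zeta> by (auto simp: mem_dilog_box)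
  then have "exp \<zeta> \<in> slit_plane" by auto
  moreover have "Li2 (exp \<zeta>) - 2 * pi * \<i> * Ln (exp \<zeta>) = 0"
    using dilog_map_eq_iff[of "exp \<zeta>"] \<zeta> Ln by simp
  moreover have "w = exp \<zeta>" if "w \<in> slit_plane" "Li2 w - 2 * pi * \<i> * Ln w = 0" for w
  proof -
    have "w \<noteq> 0" using that by force
    have "Ln w \<in> dilog_box" "dilog_map (Ln w) = Ln w"
      using dilog_zero_in_box[of w] that by auto
    then have "Ln w = \<zeta>" using fix1 \<zeta> by blast
    then show ?thesis using \<open>w \<noteq> 0\<close> by auto
  qed
  ultimately show ?thesis by blast
qed

lemma w0_in_slit_plane: "w\<^sub>0 \<in> slit_plane"
  and w0_eq: "Li2 w\<^sub>0 = 2 * pi * \<i> * Ln w\<^sub>0"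
  using theI'[OF dilog_zero_unique] by (simp_all add: w\<^sub>0_def)

section \<open>Localization of the zero\<close>

text \<open>Decimal approximation of \<open>1 - w\<^sub>0\<close>.\<close>

definition x_approx :: complex where
  "x_approx = Complex (838 / 10000) (1825 / 10000)"

lemma Re_x_approx [simp]: "Re x_approx = 838 / 10000"
  and Im_x_approx [simp]: "Im x_approx = 1825 / 10000"
  by (simp_all add: x_approx_def)

lemma x_approx_nonzero: "x_approx \<noteq> 0" "1 - x_approx \<noteq> 0"
  by (simp_all add: complex_eq_iff)

lemma norm_x_approx: "2008 / 10000 \<le> norm x_approx" "norm x_approx \<le> 2009 / 10000"
  unfolding cmod_def by (intro real_le_rsqrt real_le_lsqrt; simp add: power2_eq_square)+

lemma Ln_partial_sum_x_approx:
  "(\<Sum>n<5. x_approx ^ n / of_nat n) =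
    Complex (8160241191853483 / 120000000000000000) (117988196186059 / 600000000000000)"
  by (simp add: eval_nat_numeral complex_eq_iff)

lemma Li2_partial_sum_x_approx:
  "(\<Sum>n<4. 1 / (of_nat n)\<^sup>2 * x_approx ^ n) =
    Complex (343638358361 / 4500000000000) (68363485811 / 360000000000)"
  by (simp add: eval_nat_numeral complex_eq_iff)

lemma Re_Ln_x_approx: "-(1625 / 1000) \<le> Re (Ln x_approx)" "Re (Ln x_approx) \<le> -(16 / 10)"
proof -
  have "ln (10000 / 2008) \<le> (13 / 8 :: real)"
    using ln_le_ratio[of "10000 / 2008" 8 13] by (simp add: power_divide)
  then have "- (1625 / 1000) \<le> ln (2008 / 10000 :: real)" by (simp add: ln_div)
  also have "\<dots> \<le> ln (norm x_approx)" using norm_x_approx by (intro ln_mono) auto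
  finally show "-(1625 / 1000) \<le> Re (Ln x_approx)" by (simp add: x_approx_nonzero)
  have "ln (norm x_approx) \<le> ln (2009 / 10000)"
    using norm_x_approx x_approx_nonzero by (intro ln_mono) auto
  also have "\<dots> = - ln (10000 / 2009)" by (simp add: ln_div)
  also have "\<dots> \<le> - (16 / 10)"
    using ratio_le_ln[of "10000 / 2009" 5 8] by (simp add: power_divide)
  finally show "Re (Ln x_approx) \<le> -(16 / 10)" by (simp add: x_approx_nonzero)
qed

lemma Im_Ln_x_approx: "pi / 2 - 4375 / 10000 \<le> Im (Ln x_approx)" "Im (Ln x_approx) \<le> pi / 2 - 425 / 1000"
proof -
  \<comment> \<open>The argument is about 1.14; its complement \<open>\<alpha>\<close>, about 0.43,
    is a small angle, where the half-angle and quadratic cosine bounds are accurate.\<close>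
  define \<alpha> where "\<alpha> = pi / 2 - Im (Ln x_approx)"
  have "\<bar>Im (Ln x_approx)\<bar> < pi / 2" by (rule Re_Ln_pos_lt_imp) simp
  moreover have "0 < Im (Ln x_approx)" by (rule Im_Ln_pos_lt_imp[THEN conjunct1]) simp
  ultimately have \<alpha>: "0 \<le> \<alpha>" "\<alpha> \<le> pi / 2" by (auto simp: \<alpha>_def)
  have cos: "cos \<alpha> = 1825 / 10000 / norm x_approx"
    by (simp add: \<alpha>_def cos_diff sin_Im_Ln[OF x_approx_nonzero(1)])
  have sin: "sin \<alpha> = 838 / 10000 / norm x_approx"
    by (simp add: \<alpha>_def sin_diff cos_Im_Ln[OF x_approx_nonzero(1)])
  have pos: "0 < norm x_approx" using x_approx_nonzero by simp
  have "sin \<alpha> / (cos \<alpha> + 1) = 838 / (1825 + 10000 * norm x_approx)"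
    unfolding cos sin using pos by (simp add: field_simps add_pos_pos)
  also have "\<dots> \<le> 838 / (1825 + 2008)"
    using norm_x_approx by (intro divide_left_mono) auto
  finally have "\<alpha> \<le> 4375 / 10000" using le_2_tan_half[OF \<alpha>] by simp
  then show "pi / 2 - 4375 / 10000 \<le> Im (Ln x_approx)" by (simp add: \<alpha>_def)
  have "cos \<alpha> \<le> 1825 / 2008"
    unfolding cos using norm_x_approx pos by (simp add: field_simps)
  then have "1 - \<alpha>\<^sup>2 / 2 \<le> 1825 / 2008" using cos_ge_quadratic[of \<alpha>] by linarith
  then have "(425 / 1000)\<^sup>2 \<le> \<alpha>\<^sup>2" by (simp add: power2_eq_square)
  then have "425 / 1000 \<le> \<alpha>" using \<alpha>(1) by (rule power2_le_imp_le)
  then show "Im (Ln x_approx) \<le> pi / 2 - 425 / 1000" by (simp add: \<alpha>_def)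
qed

lemma Ln_one_minus_x_approx:
  "norm (Ln (1 - x_approx) + (\<Sum>n<5. x_approx ^ n / of_nat n)) \<le> 83 / 1000000"
proof -
  let ?r = "norm x_approx"
  have "norm (- Ln (1 - x_approx) - (\<Sum>n<5. x_approx ^ n / of_nat n)) \<le> ?r ^ 5 / (real 5 * (1 - ?r))"
    using norm_x_approx by (intro norm_Ln_minus_partial_sum_le) auto
  also have "\<dots> \<le> (2009 / 10000) ^ 5 / (real 5 * (1 - 2009 / 10000))"
    using norm_x_approx by (intro frac_le power_mono mult_left_mono) auto
  also have "\<dots> \<le> 83 / 1000000" by (simp add: power_divide)
  finally show ?thesis
    by (metis (no_types) add.commute minus_add_distrib norm_minus_cancel uminus_add_conv_diff)
qed

lemma Li2_x_approx:
  "norm (Li2 x_approx - (\<Sum>n<4. 1 / (of_nat n)\<^sup>2 * x_approx ^ n)) \<le> 13 / 100000"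
proof -
  let ?r = "norm x_approx"
  have "norm (Li2 x_approx - (\<Sum>n<4. 1 / (of_nat n)\<^sup>2 * x_approx ^ n)) \<le> ?r ^ 4 / ((real 4)\<^sup>2 * (1 - ?r))"
    using norm_x_approx by (intro norm_Li2_minus_partial_sum_le_geometric) auto
  also have "\<dots> \<le> (2009 / 10000) ^ 4 / ((real 4)\<^sup>2 * (1 - 2009 / 10000))"
    using norm_x_approx by (intro frac_le power_mono mult_left_mono) auto
  also have "\<dots> \<le> 13 / 100000" by (simp add: power_divide)
  finally show ?thesis .
qed

lemma Re_Im_Ln_one_minus_x_approx:
  "\<bar>Re (Ln (1 - x_approx)) + 68 / 1000\<bar> \<le> 1 / 10000"
  "\<bar>Im (Ln (1 - x_approx)) + 19665 / 100000\<bar> \<le> 1 / 10000"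
  using order_trans[OF abs_Re_le_cmod Ln_one_minus_x_approx]
    order_trans[OF abs_Im_le_cmod Ln_one_minus_x_approx]
  unfolding Ln_partial_sum_x_approx plus_complex.sel complex.sel abs_le_iff by linarith+

lemma Ln_one_minus_x_approx_in_box: "Ln (1 - x_approx) \<in> dilog_box"
  using Re_Im_Ln_one_minus_x_approx unfolding mem_dilog_box abs_le_iff by auto

text \<open>The reflection formula moves the evaluation of the dilogarithm from \<open>1 - x_approx\<close>, where its
  series converges slowly, to \<open>x_approx\<close>.\<close>

lemma dilog_map_Ln_one_minus_x_approx:
  "norm (dilog_map (Ln (1 - x_approx)) - Ln (1 - x_approx)) \<le> 16 / 10000"
proof -
  define L where "L = Ln (1 - x_approx)"
  \<comment> \<open>\<open>S\<close> and \<open>M\<close> are exact partial sums approximating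
    \<open>- L\<close> and \<open>Li2 x_approx\<close>, \<open>\<mu>\<close> is the midpoint of the
    enclosure of \<open>Ln x_approx\<close>, and \<open>R\<close> is the residual computed from
    these values.\<close>
  define S where "S = Complex (8160241191853483 / 120000000000000000) (117988196186059 / 600000000000000)"
  define M where "M = Complex (343638358361 / 4500000000000) (68363485811 / 360000000000)"
  define \<mu> where "\<mu> = Complex (-(16125 / 10000)) (pi / 2 - 43125 / 100000)"
  define R where "R = of_real (pi\<^sup>2 / 6) - M + S * (\<mu> + 2 * pi * \<i>)"
  have norm_le: "norm z \<le> a + b" if "- a \<le> Re z" "Re z \<le> a" "- b \<le> Im z" "Im z \<le> b" for z a b
    using cmod_le[of z] that by linarith
  have tri: "norm (a - b - d - e) \<le> norm a + norm b + norm d + norm e" for a b d e :: complex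
    using norm_triangle_ineq4[of "a - b - d" e] norm_triangle_ineq4[of "a - b" d]
      norm_triangle_ineq4[of a b] by linarith
  have LS: "norm (L + S) \<le> 83 / 1000000"
    using Ln_one_minus_x_approx by (simp only: L_def S_def Ln_partial_sum_x_approx)
  have LM: "norm (Li2 x_approx - M) \<le> 13 / 100000"
    using Li2_x_approx by (simp only: M_def Li2_partial_sum_x_approx)
  have "norm (Ln x_approx - \<mu>) \<le> 125 / 10000 + 63 / 10000"
    using Re_Ln_x_approx Im_Ln_x_approx by (intro norm_le) (auto simp: \<mu>_def)
  moreover have "norm L \<le> 681 / 10000 + 1968 / 10000"
    using Re_Im_Ln_one_minus_x_approx unfolding L_def abs_le_iff by (intro norm_le) auto
  ultimately have 1: "norm (L * (Ln x_approx - \<mu>)) \<le> (2649 / 10000) * (188 / 10000)"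
    unfolding norm_mult by (intro mult_mono) auto
  have "norm (\<mu> + 2 * pi * \<i>) \<le> 17 / 10 + 8"
    using pi_approx by (intro norm_le) (auto simp: \<mu>_def)
  then have 2: "norm ((L + S) * (\<mu> + 2 * pi * \<i>)) \<le> (83 / 1000000) * (97 / 10)"
    unfolding norm_mult using LS by (intro mult_mono) auto
  have "norm R \<le> 1 / 1000 + 25 / 10000"
    using pi_approx pi_squared_bounds
    by (intro norm_le) (auto simp: R_def S_def M_def \<mu>_def field_simps)
  moreover have "Li2 (1 - x_approx) + Li2 x_approx + L * Ln x_approx = of_real (pi\<^sup>2 / 6)"
  proof -
    have "(norm (1 - x_approx))\<^sup>2 < 1\<^sup>2" by (simp only: cmod_power2) (simp add: power2_eq_square)
    then have "norm (1 - x_approx) < 1" by (rule power2_less_imp_less) simp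
    then show ?thesis
      using Li2_reflection[of "1 - x_approx"] norm_x_approx by (simp add: L_def)
  qed
  \<comment> \<open>Besides the explicit \<open>R\<close>, each summand carries one approximation
    error: that of \<open>Li2 x_approx\<close>, of \<open>L\<close> and of
    \<open>Ln x_approx\<close>, in this order.\<close>
  then have "Li2 (1 - x_approx) - 2 * pi * \<i> * L =
      R - (Li2 x_approx - M) - (L + S) * (\<mu> + 2 * pi * \<i>) - L * (Ln x_approx - \<mu>)"
    by (simp add: R_def algebra_simps)
  then have "norm (Li2 (1 - x_approx) - 2 * pi * \<i> * L) \<le>
      norm R + norm (Li2 x_approx - M) + norm ((L + S) * (\<mu> + 2 * pi * \<i>)) + norm (L * (Ln x_approx - \<mu>))"
    by (simp only: tri)
  ultimately have "norm (Li2 (1 - x_approx) - 2 * pi * \<i> * L) \<le> 95 / 10000"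
    using LM 1 2 by linarith
  also have "\<dots> \<le> 16 / 10000 * (2 * pi)" using pi_approx by simp
  finally have "norm (Li2 (1 - x_approx) - 2 * pi * \<i> * L) / (2 * pi) \<le> 16 / 10000"
    by (simp add: field_simps)
  moreover have "dilog_map L - L = (Li2 (1 - x_approx) - 2 * pi * \<i> * L) / (2 * pi * \<i>)"
    using x_approx_nonzero by (simp add: dilog_map_def L_def field_simps)
  ultimately show ?thesis
    by (simp add: L_def norm_divide norm_mult)
qed

section \<open>Numerical consequences for \<open>w\<^sub>0\<close>, \<open>z\<^sub>0\<close> and the
  slope \<open>v\<close>\<close>

lemma w0_nonzero: "w\<^sub>0 \<noteq> 0"
  using w0_in_slit_plane by force

text \<open>A posteriori estimate of the contraction principle: the residual 0.0016 divided by
  \<open>1 - 6 / 10\<close>.\<close>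

lemma Ln_w0_near: "norm (Ln w\<^sub>0 - Ln (1 - x_approx)) \<le> 4 / 1000"
proof -
  let ?a = "Ln w\<^sub>0" and ?b = "Ln (1 - x_approx)"
  have a: "?a \<in> dilog_box" "dilog_map ?a = ?a"
    using dilog_zero_in_box[OF w0_in_slit_plane w0_eq] .
  have "norm (?a - ?b) = norm ((dilog_map ?a - dilog_map ?b) + (dilog_map ?b - ?b))"
    by (simp add: a)
  also have "\<dots> \<le> norm (dilog_map ?a - dilog_map ?b) + norm (dilog_map ?b - ?b)"
    by (rule norm_triangle_ineq)
  also have "\<dots> \<le> 6 / 10 * norm (?a - ?b) + 16 / 10000"
    using dilog_map_contraction[OF a(1) Ln_one_minus_x_approx_in_box] dilog_map_Ln_one_minus_x_approx
    by (intro add_mono) auto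
  finally show ?thesis by simp
qed

text \<open>The true value is about -0.068; the bound -0.063 is the threshold that
  \<open>Re (p z)\<close> has to exceed on the vertical segments.\<close>

lemma ln_norm_w0: "ln (norm w\<^sub>0) \<le> - (63 / 1000)"
proof -
  have "Re (Ln w\<^sub>0 - Ln (1 - x_approx)) \<le> 4 / 1000"
    using Ln_w0_near complex_Re_le_cmod order_trans by blast
  then have "Re (Ln w\<^sub>0) \<le> Re (Ln (1 - x_approx)) + 4 / 1000" by simp
  then show ?thesis
    using Re_Im_Ln_one_minus_x_approx(1) w0_nonzero unfolding abs_le_iff by simp
qed

lemma norm_w0_less_1: "norm w\<^sub>0 < 1"
  using dilog_zero_lower_half_disc[OF w0_in_slit_plane w0_eq] by simp

lemma Im_w0_neg: "Im w\<^sub>0 < 0"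
  using dilog_zero_lower_half_disc[OF w0_in_slit_plane w0_eq] by simp

text \<open>On the box \<open>exp\<close> has derivative of modulus at most 1, so the error does not
  grow on passing from the logarithm to \<open>w\<^sub>0\<close>.\<close>

lemma w0_near: "norm (w\<^sub>0 - (1 - x_approx)) \<le> 4 / 1000"
proof -
  have "norm (exp (Ln w\<^sub>0) - exp (Ln (1 - x_approx))) \<le> 1 * norm (Ln w\<^sub>0 - Ln (1 - x_approx))"
  proof (rule field_differentiable_bound)
    show "convex dilog_box" by (simp add: dilog_box_def)
    show "norm (exp z) \<le> 1" if "z \<in> dilog_box" for z :: complex
      using that by (simp add: mem_dilog_box)
    show "Ln w\<^sub>0 \<in> dilog_box" using dilog_zero_in_box[OF w0_in_slit_plane w0_eq] by blast
  qed (auto intro: Ln_one_minus_x_approx_in_box derivative_eq_intros)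
  then show ?thesis using Ln_w0_near x_approx_nonzero w0_nonzero by simp
qed

lemma one_minus_w0_bounds:
  "Re (1 - w\<^sub>0) \<ge> 0" "1785 / 10000 \<le> Im (1 - w\<^sub>0)"
  "1968 / 10000 \<le> norm (1 - w\<^sub>0)" "norm (1 - w\<^sub>0) \<le> 2049 / 10000"
proof -
  show "Re (1 - w\<^sub>0) \<ge> 0" using norm_w0_less_1 complex_Re_le_cmod[of "w\<^sub>0"] by simp
  have "\<bar>Im (w\<^sub>0 - (1 - x_approx))\<bar> \<le> 4 / 1000"
    using w0_near abs_Im_le_cmod order_trans by blast
  then show "1785 / 10000 \<le> Im (1 - w\<^sub>0)" unfolding abs_le_iff by simp
  have "norm (1 - w\<^sub>0) \<le> norm x_approx + norm (w\<^sub>0 - (1 - x_approx))"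
    using norm_triangle_ineq4[of "x_approx" "w\<^sub>0 - (1 - x_approx)"] by simp
  then show "norm (1 - w\<^sub>0) \<le> 2049 / 10000" using w0_near norm_x_approx by linarith
  have "norm x_approx \<le> norm (1 - w\<^sub>0) + norm (w\<^sub>0 - (1 - x_approx))"
    using norm_triangle_ineq[of "1 - w\<^sub>0" "w\<^sub>0 - (1 - x_approx)"] by simp
  then show "1968 / 10000 \<le> norm (1 - w\<^sub>0)" using w0_near norm_x_approx by linarith
qed

lemma one_minus_w0_nonzero: "1 - w\<^sub>0 \<noteq> 0"
  using one_minus_w0_bounds(3) by auto

lemma Re_z0: "Re z\<^sub>0 = 1 + Im (Ln (1 - w\<^sub>0)) / (2 * pi)"
  and Im_z0: "Im z\<^sub>0 = - ln (norm (1 - w\<^sub>0)) / (2 * pi)"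
  using one_minus_w0_nonzero by (simp_all add: z\<^sub>0_def Re_divide Im_divide power2_eq_square)

lemma Im_Ln_one_minus_w0: "1 \<le> Im (Ln (1 - w\<^sub>0))" "Im (Ln (1 - w\<^sub>0)) \<le> pi / 2"
proof -
  let ?\<theta> = "Im (Ln (1 - w\<^sub>0))"
  have "\<bar>?\<theta>\<bar> \<le> pi / 2"
    using Re_Ln_pos_le one_minus_w0_nonzero one_minus_w0_bounds(1) by blast
  then show "?\<theta> \<le> pi / 2" by simp
  have pos: "0 < ?\<theta>" using Im_w0_neg by (intro Im_Ln_pos_lt_imp[THEN conjunct1]) simp
  show "1 \<le> ?\<theta>"
  proof (rule ccontr)
    assume "\<not> 1 \<le> ?\<theta>"
    \<comment> \<open>An angle below 1 would have cosine at least 1/2, hence squared sine at most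
      0.75, whereas \<open>(1785 / 2049)\<^sup>2\<close> is about 0.759.\<close>
    then have "1 - 1\<^sup>2 / 2 \<le> cos ?\<theta>" using pos by (intro cos_ge_of_abs_le) auto
    then have "(1 / 2)\<^sup>2 \<le> (cos ?\<theta>)\<^sup>2" by (intro power_mono) auto
    then have "(sin ?\<theta>)\<^sup>2 \<le> 3 / 4" by (simp add: sin_squared_eq power_divide)
    moreover have "1785 / 2049 \<le> sin ?\<theta>"
    proof -
      have "1785 / 2049 = (1785 / 10000) / (2049 / 10000 :: real)" by simp
      also have "\<dots> \<le> Im (1 - w\<^sub>0) / norm (1 - w\<^sub>0)"
        using one_minus_w0_bounds by (intro frac_le) auto
      finally show ?thesis using sin_Im_Ln[OF one_minus_w0_nonzero] by linarith
    qed
    then have "(1785 / 2049)\<^sup>2 \<le> (sin ?\<theta>)\<^sup>2" by (intro power_mono) auto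
    ultimately show False by (simp add: power2_eq_square)
  qed
qed

lemma Re_z0_bounds: "11 / 10 \<le> Re z\<^sub>0" "Re z\<^sub>0 \<le> 5 / 4"
proof -
  have "1 / 10 * (2 * pi) \<le> Im (Ln (1 - w\<^sub>0))" "Im (Ln (1 - w\<^sub>0)) \<le> 1 / 4 * (2 * pi)"
    using Im_Ln_one_minus_w0 pi_approx by auto
  then have "1 / 10 \<le> Im (Ln (1 - w\<^sub>0)) / (2 * pi)" "Im (Ln (1 - w\<^sub>0)) / (2 * pi) \<le> 1 / 4"
    by (simp_all only: pos_le_divide_eq pos_divide_le_eq pi_gt_zero zero_less_mult_iff) simp_all
  then show "11 / 10 \<le> Re z\<^sub>0" "Re z\<^sub>0 \<le> 5 / 4" by (simp_all add: Re_z0)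
qed

lemma v_eq: "v = - ln (norm (1 - w\<^sub>0)) / (2 * pi + Im (Ln (1 - w\<^sub>0)))"
  by (simp add: v_def Re_z0 Im_z0 field_simps)

lemma v_bounds: "0 < v" "v \<le> 225 / 1000"
proof -
  have "ln (norm (1 - w\<^sub>0)) \<le> norm (1 - w\<^sub>0) - 1"
    using one_minus_w0_nonzero by (intro ln_le_minus_one) auto
  then have neg: "ln (norm (1 - w\<^sub>0)) < 0" using one_minus_w0_bounds by linarith
  have den: "728 / 100 \<le> 2 * pi + Im (Ln (1 - w\<^sub>0))"
    using Im_Ln_one_minus_w0(1) pi_approx(1) by simp
  show "0 < v" unfolding v_eq using neg den by (intro divide_pos_pos) auto
  have "ln (10000 / 1968) \<le> (18 / 11 :: real)"
    using ln_le_ratio[of "10000 / 1968" 11 18] by (simp add: power_divide)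
  then have "- (18 / 11) \<le> ln (1968 / 10000 :: real)" by (simp add: ln_div)
  also have "\<dots> \<le> ln (norm (1 - w\<^sub>0))" using one_minus_w0_bounds by (intro ln_mono) auto
  finally have "v \<le> (18 / 11) / (728 / 100)"
    unfolding v_eq using den neg by (intro frac_le) auto
  then show "v \<le> 225 / 1000" by simp
qed

lemma z0_eq: "z\<^sub>0 = of_real (Re z\<^sub>0) * Complex 1 v"
  using Re_z0_bounds by (simp add: complex_eq_iff v_def)

lemma exp_z0: "exp (2 * pi * \<i> * z\<^sub>0) = 1 - w\<^sub>0"
proof -
  have "2 * pi * \<i> * z\<^sub>0 = 2 * pi * \<i> + Ln (1 - w\<^sub>0)"
    by (simp add: z\<^sub>0_def field_simps)
  then show ?thesis using one_minus_w0_nonzero by (simp add: exp_add)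
qed

text \<open>The defining equation of \<open>w\<^sub>0\<close> and the reflection formula turn the numerator into
  \<open>Ln w\<^sub>0 * (2 * pi * \<i> + Ln (1 - w\<^sub>0))\<close>.\<close>

lemma p_z0: "p z\<^sub>0 = Ln w\<^sub>0"
proof -
  have "norm (1 - w\<^sub>0) < 1" using one_minus_w0_bounds by linarith
  then have "Li2 w\<^sub>0 + Li2 (1 - w\<^sub>0) + Ln w\<^sub>0 * Ln (1 - w\<^sub>0) = Li2 1"
    using Li2_reflection norm_w0_less_1 by (simp add: Li2_1)
  then have "Li2 1 - Li2 (1 - w\<^sub>0) = Ln w\<^sub>0 * (2 * pi * \<i> + Ln (1 - w\<^sub>0))"
    by (simp add: w0_eq algebra_simps)
  also have "\<dots> = Ln w\<^sub>0 * (2 * pi * \<i> * z\<^sub>0)" by (simp add: z\<^sub>0_def field_simps)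
  finally have "Li2 1 - Li2 (1 - w\<^sub>0) = Ln w\<^sub>0 * (2 * pi * \<i> * z\<^sub>0)" .
  moreover have "z\<^sub>0 \<noteq> 0" using Re_z0_bounds by auto
  ultimately show ?thesis unfolding p_def exp_z0 by simp
qed

section \<open>The values of p along rays\<close>

text \<open>The factor \<open>t\<close> cancels the one in the denominator of \<open>p\<close>, so
  that only \<open>Li2\<close> along the ray remains to be differentiated.\<close>

definition ray_p :: "real \<Rightarrow> real \<Rightarrow> real" where
  "ray_p s t = t * Re (p (of_real t * Complex 1 s))"

definition ray_exp :: "real \<Rightarrow> real \<Rightarrow> complex" where
  "ray_exp s t = exp (2 * pi * \<i> * (of_real t * Complex 1 s))"

lemma ray_exp_eq: "ray_exp s t = of_real (exp (- (2 * pi * s * t))) * cis (2 * pi * t)"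
proof -
  have "2 * pi * \<i> * (of_real t * Complex 1 s) = of_real (- (2 * pi * s * t)) + \<i> * of_real (2 * pi * t)"
    by (simp add: complex_eq_iff)
  then show ?thesis by (simp only: ray_exp_def exp_add exp_of_real cis_conv_exp)
qed

lemma Re_ray_exp: "Re (ray_exp s t) = exp (- (2 * pi * s * t)) * cos (2 * pi * t)"
  and Im_ray_exp: "Im (ray_exp s t) = exp (- (2 * pi * s * t)) * sin (2 * pi * t)"
  and norm_ray_exp: "norm (ray_exp s t) = exp (- (2 * pi * s * t))"
  by (simp_all add: ray_exp_eq norm_mult)

lemma complex_slope_nonzero [simp]: "Complex 1 s \<noteq> 0"
  by (simp add: complex_eq_iff)

lemma ray_p_eq:
  assumes "t \<noteq> 0"
  shows "ray_p s t = Re ((Li2 1 - Li2 (ray_exp s t)) / (2 * pi * \<i> * Complex 1 s))"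
proof -
  have "of_real t * p (of_real t * Complex 1 s) = (Li2 1 - Li2 (ray_exp s t)) / (2 * pi * \<i> * Complex 1 s)"
    using assms unfolding p_def ray_exp_def by (simp add: field_simps)
  moreover have "ray_p s t = Re (of_real t * p (of_real t * Complex 1 s))"
    by (simp add: ray_p_def)
  ultimately show ?thesis by simp
qed

text \<open>The factor \<open>k\<close> from differentiating \<open>exp (k * t)\<close> cancels
  against the denominator, leaving \<open>Ln (1 - e)\<close>. The positive slope keeps
  \<open>e\<close> inside the open unit disc.\<close>

lemma ray_p_has_real_derivative:
  assumes "0 < s" "0 < t"
  shows "(ray_p s has_real_derivative ln (norm (1 - ray_exp s t))) (at t)"
proof -
  define k where "k = 2 * pi * \<i> * Complex 1 s"
  have k: "k \<noteq> 0" by (simp add: k_def)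
  define e where "e = ray_exp s t"
  have e_eq: "ray_exp s t = exp (k * of_real t)" for t
    by (simp add: ray_exp_def k_def mult_ac)
  have e: "norm e < 1" "e \<noteq> 0"
    using assms by (simp_all add: e_def norm_ray_exp) (simp add: e_eq)
  have nz: "1 - e \<noteq> 0" using e by auto
  have "((\<lambda>z. exp (k * z)) has_field_derivative e * k) (at (of_real t))"
    unfolding e_def e_eq by (auto intro!: derivative_eq_intros)
  moreover have "(Li2 has_field_derivative - Ln (1 - e) / e) (at (exp (k * of_real t)))"
    using Li2_has_field_derivative[OF e] by (simp add: e_def e_eq)
  ultimately have "((\<lambda>z. Li2 (exp (k * z))) has_field_derivative - Ln (1 - e) / e * (e * k)) (at (of_real t))"
    by (rule DERIV_chain2[rotated])
  then have "((\<lambda>z. (Li2 1 - Li2 (exp (k * z))) / k) has_field_derivative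
      (0 - (- Ln (1 - e) / e) * (e * k)) / k) (at (of_real t))"
    by (intro DERIV_cdivide DERIV_diff DERIV_const)
  moreover have "(0 - (- Ln (1 - e) / e) * (e * k)) / k = Ln (1 - e)"
    using e k by simp
  ultimately have "((\<lambda>t. (Li2 1 - Li2 (exp (k * of_real t))) / k) has_vector_derivative Ln (1 - e)) (at t)"
    by (intro has_vector_derivative_real_field) simp
  then have "((\<lambda>t. Re ((Li2 1 - Li2 (exp (k * of_real t))) / k)) has_vector_derivative Re (Ln (1 - e))) (at t)"
    by (rule bounded_linear.has_vector_derivative[OF bounded_linear_Re])
  then have "((\<lambda>t. Re ((Li2 1 - Li2 (ray_exp s t)) / k)) has_real_derivative ln (norm (1 - ray_exp s t))) (at t)"
    using nz by (simp add: has_real_derivative_iff_has_vector_derivative e_def e_eq)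
  then show ?thesis
    by (rule has_field_derivative_transform_within_open[where S = "{0<..}"])
       (use assms in \<open>auto simp: ray_p_eq k_def\<close>)
qed

lemma continuous_on_ray_p:
  assumes "0 \<le> s"
  shows "continuous_on {0<..} (ray_p s)"
proof -
  have "continuous_on {0<..} (\<lambda>t. Re ((Li2 1 - Li2 (ray_exp s t)) / (2 * pi * \<i> * Complex 1 s)))"
  proof (intro continuous_intros continuous_on_compose2[OF continuous_on_Li2])
    show "continuous_on {0<..} (ray_exp s)" unfolding ray_exp_def by (intro continuous_intros)
  qed (use assms in \<open>auto simp: norm_ray_exp\<close>)
  then show ?thesis by (rule continuous_on_eq) (auto simp: ray_p_eq)
qed

text \<open>At slope 0 the exponential lies on the unit circle, out of reach of the derivative
  formula. The real endpoints of the vertical segments are therefore treated as limits of points of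
  positive slope.\<close>

lemma Re_p_tendsto_slope_0:
  assumes "0 < t"
  shows "((\<lambda>s. Re (p (of_real t * Complex 1 s))) \<longlongrightarrow> Re (p (of_real t))) (at_right 0)"
proof -
  have 1: "continuous_on {0..} (\<lambda>s. 2 * pi * \<i> * (of_real t * Complex 1 s))"
    unfolding Complex_eq by (intro continuous_intros)
  have 2: "continuous_on {0..} (\<lambda>s. Li2 (exp (2 * pi * \<i> * (of_real t * Complex 1 s))))"
  proof (rule continuous_on_compose2[OF continuous_on_Li2 continuous_on_exp[OF 1]])
    show "(\<lambda>s. exp (2 * pi * \<i> * (of_real t * Complex 1 s))) ` {0..} \<subseteq> cball 0 1"
    proof (rule image_subsetI)
      fix s :: real assume "s \<in> {0..}"
      then have "norm (ray_exp s t) \<le> 1"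
        using assms by (simp add: norm_ray_exp)
      then show "exp (2 * pi * \<i> * (of_real t * Complex 1 s)) \<in> cball 0 1"
        by (simp only: mem_cball_0 ray_exp_def)
    qed
  qed
  have "continuous_on {0..} (\<lambda>s. Re (p (of_real t * Complex 1 s)))"
    unfolding p_def using assms
    by (intro continuous_on_Re continuous_on_divide continuous_on_diff continuous_on_const 1 2) auto
  then have "((\<lambda>s. Re (p (of_real t * Complex 1 s))) \<longlongrightarrow> Re (p (of_real t * Complex 1 0))) (at 0 within {0..})"
    unfolding continuous_on_def by blast
  moreover have "of_real t * Complex 1 0 = of_real t" by (simp add: complex_eq_iff)
  ultimately show ?thesis
    by (simp only: at_within_Ici_at_right)
qed

lemma Im_Li2_of_real:
  assumes "\<bar>r\<bar> \<le> 1"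
  shows "Im (Li2 (of_real r)) = 0"
proof -
  have "(\<lambda>n. 1 / (of_nat n)\<^sup>2 * complex_of_real r ^ n) sums Li2 (of_real r)"
    using assms by (intro Li2_sums) auto
  then have "(\<lambda>n. Im (1 / (of_nat n)\<^sup>2 * complex_of_real r ^ n)) sums Im (Li2 (of_real r))"
    by (rule sums_Im)
  moreover have "Im (1 / (of_nat n)\<^sup>2 * complex_of_real r ^ n) = 0" for n
  proof -
    have "1 / (of_nat n)\<^sup>2 * complex_of_real r ^ n = of_real (1 / (of_nat n)\<^sup>2 * r ^ n)" by simp
    then show ?thesis by (simp only: Im_complex_of_real)
  qed
  ultimately have "(\<lambda>n. 0) sums Im (Li2 (of_real r))" by (simp only:)
  then show ?thesis using sums_unique2[OF sums_zero] by metis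
qed

text \<open>A real exponential makes the numerator a real \<open>A >= 0\<close>, and the reciprocal
  of the denominator has real part \<open>- s / (2 * pi * (1 + s\<^sup>2))\<close>. Replacing
  \<open>1 + s\<^sup>2\<close> by 1 and \<open>Re (Li2 r)\<close> by \<open>r\<close> only lowers
  the value.\<close>

lemma ray_p_ge_of_real:
  assumes "0 < s" "0 < t" "ray_exp s t = of_real r" "r < 1" "\<bar>r\<bar> \<le> 1"
  shows "- ((pi\<^sup>2 / 6 - r) * s / (2 * pi)) \<le> ray_p s t"
proof -
  define A where "A = pi\<^sup>2 / 6 - Re (Li2 (of_real r))"
  have A: "Li2 1 - Li2 (ray_exp s t) = of_real A"
    unfolding assms(3) using Im_Li2_of_real[OF assms(5)] by (simp add: complex_eq_iff A_def Li2_1)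
  have "norm (Li2 (of_real r)) \<le> pi\<^sup>2 / 6"
    using assms by (intro norm_Li2_le) auto
  then have A_nonneg: "0 \<le> A"
    using complex_Re_le_cmod[of "Li2 (of_real r)"] by (simp add: A_def)
  have "2 * pi * \<i> * Complex 1 s = Complex (- (2 * pi * s)) (2 * pi)"
    by (simp add: complex_eq_iff)
  then have "ray_p s t = A * (- (2 * pi * s)) / ((- (2 * pi * s))\<^sup>2 + (2 * pi)\<^sup>2)"
    using assms A by (simp add: ray_p_eq Re_divide)
  also have "(- (2 * pi * s))\<^sup>2 + (2 * pi)\<^sup>2 = (2 * pi) * (2 * pi * (1 + s\<^sup>2))"
    by (simp add: power2_eq_square algebra_simps)
  also have "A * (- (2 * pi * s)) / ((2 * pi) * (2 * pi * (1 + s\<^sup>2))) = - (A / (2 * pi * (1 + s\<^sup>2)) * s)"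
    by simp
  finally have "ray_p s t = - (A / (2 * pi * (1 + s\<^sup>2)) * s)" .
  moreover have "A / (2 * pi * (1 + s\<^sup>2)) * s \<le> A / (2 * pi) * s"
    using A_nonneg assms by (intro mult_right_mono divide_left_mono mult_pos_pos add_pos_nonneg) auto
  moreover have "A / (2 * pi) * s \<le> (pi\<^sup>2 / 6 - r) / (2 * pi) * s"
    using Re_Li2_of_real_ge[OF assms(4)] assms unfolding A_def
    by (intro mult_right_mono divide_right_mono) auto
  ultimately show ?thesis by simp
qed

lemma norm_one_minus_ray_exp_squared:
  "(norm (1 - ray_exp s t))\<^sup>2 = 1 - 2 * exp (- (2 * pi * s * t)) * cos (2 * pi * t) + (exp (- (2 * pi * s * t)))\<^sup>2"
proof -
  have "(1 - r * C)\<^sup>2 + (r * S)\<^sup>2 = 1 - 2 * r * C + r\<^sup>2 * (C\<^sup>2 + S\<^sup>2)" for r C S :: real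
    by algebra
  then show ?thesis
    by (simp add: cmod_power2 Re_ray_exp Im_ray_exp)
qed

section \<open>The three segments\<close>

text \<open>The squared norm has derivative
  \<open>4 * pi * r * (sin \<theta> + s * cos \<theta> - s * r)\<close> with \<theta> in the first
  quadrant. There \<open>sin \<theta> + cos \<theta> >= 1\<close>, so for \<open>s <= 1\<close> the
  bracket is at least \<open>s - s * r\<close>, which is positive.\<close>

lemma norm_one_minus_ray_exp_less:
  assumes "0 < s" "s \<le> 1" "1 \<le> a" "a < b" "b \<le> 5 / 4"
  shows "norm (1 - ray_exp s a) < norm (1 - ray_exp s b)"
proof -
  define N where "N t = 1 - 2 * exp (- (2 * pi * s * t)) * cos (2 * pi * t) + (exp (- (2 * pi * s * t)))\<^sup>2" for t
  have "N a < N b"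
  proof (rule DERIV_pos_imp_increasing_open[OF \<open>a < b\<close>])
    fix t assume t: "a < t" "t < b"
    define r where "r = exp (- (2 * pi * s * t))"
    define \<theta> where "\<theta> = 2 * pi * (t - 1)"
    have "0 < \<theta>" using t assms by (simp add: \<theta>_def)
    moreover have "2 * pi * (t - 1) < 2 * pi * (1 / 4)"
      using t assms by (intro mult_strict_left_mono) auto
    then have "\<theta> < pi / 2" by (simp add: \<theta>_def)
    ultimately have pos: "0 < sin \<theta>" "0 < cos \<theta>"
      using pi_gt_zero by (auto intro!: sin_gt_zero cos_gt_zero_pi)
    have per: "2 * pi * t = \<theta> + 2 * pi" by (simp add: \<theta>_def algebra_simps)
    have "1 = (sin \<theta>)\<^sup>2 + (cos \<theta>)\<^sup>2" by simp
    also have "\<dots> \<le> sin \<theta> + cos \<theta>"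
      using pos by (intro add_mono) (auto simp: power2_eq_square intro!: mult_left_le_one_le)
    finally have "s * 1 \<le> s * (sin \<theta> + cos \<theta>)" using assms by (intro mult_left_mono) auto
    also have "\<dots> \<le> 1 * sin \<theta> + s * cos \<theta>"
      using pos assms by (simp add: algebra_simps mult_left_le_one_le)
    finally have 1: "s \<le> sin \<theta> + s * cos \<theta>" by simp
    have "r < 1" using t assms by (simp add: r_def)
    then have "s * r < s * 1" using assms by (intro mult_strict_left_mono) auto
    with 1 have "0 < sin \<theta> + s * cos \<theta> - s * r" by simp
    then have "0 < 4 * pi * r * (sin \<theta> + s * cos \<theta> - s * r)"
      by (simp add: r_def)
    moreover have "(N has_real_derivative 4 * pi * r * (sin (2 * pi * t) + s * cos (2 * pi * t) - s * r)) (at t)"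
      unfolding N_def r_def
      by (auto intro!: derivative_eq_intros) (simp add: algebra_simps power2_eq_square)
    ultimately show "\<exists>y. (N has_real_derivative y) (at t) \<and> 0 < y"
      by (auto simp: per)
  qed (auto simp: N_def intro!: continuous_intros)
  then have "(norm (1 - ray_exp s a))\<^sup>2 < (norm (1 - ray_exp s b))\<^sup>2"
    by (simp only: norm_one_minus_ray_exp_squared N_def)
  then show ?thesis by (rule power2_less_imp_less) simp
qed

lemma norm_one_minus_ray_exp_ge_1:
  assumes "5 / 4 \<le> t" "t \<le> 3 / 2"
  shows "1 \<le> norm (1 - ray_exp s t)"
proof -
  have "2 * pi * (5 / 4) \<le> 2 * pi * t" "2 * pi * t \<le> 2 * pi * (3 / 2)"
    using assms by (intro mult_left_mono; simp)+
  \<comment> \<open>The angle shifted by \<open>3 * pi\<close> lies between \<open>- pi / 2\<close>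
    and 0.\<close>
  then have "0 \<le> cos (2 * pi * t - 3 * pi)" using pi_gt_zero by (intro cos_ge_zero) linarith+
  moreover have "cos (2 * pi * t - 3 * pi) = - cos (2 * pi * t)"
    by (simp add: cos_diff)
  ultimately have "2 * exp (- (2 * pi * s * t)) * cos (2 * pi * t) \<le> 0"
    by (simp add: mult_nonneg_nonpos)
  then have "1\<^sup>2 \<le> (norm (1 - ray_exp s t))\<^sup>2"
    unfolding norm_one_minus_ray_exp_squared power_one using zero_le_power2[of "exp (- (2 * pi * s * t))"] by linarith
  then show ?thesis by (rule power2_le_imp_le) simp
qed

lemma ray_exp_z0: "ray_exp v (Re z\<^sub>0) = 1 - w\<^sub>0"
  using exp_z0 by (simp add: ray_exp_def flip: z0_eq)

lemma ray_p_z0: "ray_p v (Re z\<^sub>0) = Re z\<^sub>0 * ln (norm w\<^sub>0)"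
  using w0_nonzero by (simp add: ray_p_def p_z0 flip: z0_eq)

lemma Re_p_P2:
  assumes "1 \<le> t" "t \<le> 3 / 2" "t \<noteq> Re z\<^sub>0"
  shows "ln (norm w\<^sub>0) < Re (p (of_real t * Complex 1 v))"
proof -
  define t0 where "t0 = Re z\<^sub>0"
  \<comment> \<open>\<open>F\<close> is \<open>t\<close> times the quantity whose sign is wanted.
    Both \<open>F\<close> and its derivative vanish at \<open>t0\<close>; the derivative is negative
    before and positive after, which makes \<open>t0\<close> a strict minimum.\<close>
  define F where "F t = ray_p v t - t * ln (norm w\<^sub>0)" for t
  have t0: "1 \<le> t0" "t0 \<le> 5 / 4" using Re_z0_bounds by (auto simp: t0_def)
  have N0: "norm (1 - ray_exp v t0) = norm w\<^sub>0" by (simp add: t0_def ray_exp_z0)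
  have v: "0 < v" "v \<le> 1" using v_bounds by auto
  have DF: "(F has_real_derivative ln (norm (1 - ray_exp v t)) - ln (norm w\<^sub>0)) (at t)" if "0 < t" for t
    unfolding F_def using that v by (auto intro!: derivative_eq_intros ray_p_has_real_derivative)
  have cont: "continuous_on {a..b} F" if "0 < a" for a b
    using that by (intro DERIV_continuous_on[of _ _ "\<lambda>t. ln (norm (1 - ray_exp v t)) - ln (norm w\<^sub>0)"])
      (auto intro!: DERIV_subset[OF DF])
  have F0: "F t0 = 0" by (simp add: F_def t0_def ray_p_z0)
  have nz: "0 < norm (1 - ray_exp v t)" if "0 < t" for t
  proof -
    have "norm (ray_exp v t) < 1" using v that by (simp add: norm_ray_exp)
    then show ?thesis by auto
  qed
  have "0 < F t"
  proof (cases "t < t0")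
    case True
    have "- F t < - F t0"
    proof (rule DERIV_pos_imp_increasing_open[OF True])
      fix x assume x: "t < x" "x < t0"
      have "norm (1 - ray_exp v x) < norm (1 - ray_exp v t0)"
        using x assms t0 v by (intro norm_one_minus_ray_exp_less) auto
      then have "ln (norm (1 - ray_exp v x)) < ln (norm w\<^sub>0)"
        using nz[of x] x assms w0_nonzero by (simp add: N0)
      moreover have "((\<lambda>x. - F x) has_real_derivative - (ln (norm (1 - ray_exp v x)) - ln (norm w\<^sub>0))) (at x)"
        using x assms by (intro DERIV_minus DF) auto
      ultimately show "\<exists>y. ((\<lambda>x. - F x) has_real_derivative y) (at x) \<and> 0 < y"
        by force
    qed (use assms in \<open>auto intro!: continuous_on_minus cont\<close>)
    then show ?thesis using F0 by simp
  next
    case False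
    then have gt: "t0 < t" using assms by (simp add: t0_def)
    have "F t0 < F t"
    proof (rule DERIV_pos_imp_increasing_open[OF gt])
      fix x assume x: "t0 < x" "x < t"
      have "norm w\<^sub>0 < norm (1 - ray_exp v x)"
      proof (cases "x \<le> 5 / 4")
        case True
        then have "norm (1 - ray_exp v t0) < norm (1 - ray_exp v x)"
          using x t0 v by (intro norm_one_minus_ray_exp_less) auto
        then show ?thesis by (simp add: N0)
      next
        case False
        then have "1 \<le> norm (1 - ray_exp v x)"
          using x assms by (intro norm_one_minus_ray_exp_ge_1) auto
        then show ?thesis using norm_w0_less_1 by linarith
      qed
      then have "ln (norm w\<^sub>0) < ln (norm (1 - ray_exp v x))"
        using nz[of x] x t0 w0_nonzero by simp
      then show "\<exists>y. (F has_real_derivative y) (at x) \<and> 0 < y"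
        using DF[of x] x t0 by (intro exI[of _ "ln (norm (1 - ray_exp v x)) - ln (norm w\<^sub>0)"]) auto
    qed (use t0 in \<open>auto intro!: cont\<close>)
    then show ?thesis using F0 by simp
  qed
  then have "t * ln (norm w\<^sub>0) < t * Re (p (of_real t * Complex 1 v))"
    by (simp add: F_def ray_p_def)
  then show ?thesis using assms by simp
qed

section \<open>Lower bounds on the vertical segments, starting from real values of the
  exponential\<close>

lemma ray_exp_1: "ray_exp s 1 = of_real (exp (- (2 * pi * s)))"
  by (simp add: ray_exp_eq)

lemma ray_exp_3_halves: "ray_exp s (3 / 2) = of_real (- exp (- (3 * pi * s)))"
proof -
  have "cis (3 * pi) = - 1"
  proof -
    have "3 * pi = 2 * pi + pi" by simp
    then show ?thesis by (simp only: cis_mult[symmetric]) simp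
  qed
  then show ?thesis by (simp add: ray_exp_eq mult_ac)
qed

lemma pi_bounds: "31415 / 10000 \<le> pi" "pi \<le> 31416 / 10000"
  using pi_approx by simp_all

text \<open>Supplies continuity up to \<open>t = 1\<close> of the antiderivative of a logarithm that
  is singular there.\<close>

lemma continuous_on_x_ln: "continuous_on {0..} (\<lambda>x::real. x * ln x)"
  unfolding continuous_on_eq_continuous_within
proof
  fix x :: real assume "x \<in> {0..}"
  show "continuous (at x within {0..}) (\<lambda>x. x * ln x)"
  proof (cases "x = 0")
    case True
    have "((\<lambda>x::real. x * ln x) \<longlongrightarrow> 0) (at_right 0)" by real_asymp
    then show ?thesis by (simp add: True continuous_within at_within_Ici_at_right)
  next
    case False
    then have "((\<lambda>x. x * ln x) has_real_derivative ln x + 1) (at x)"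
      using \<open>x \<in> {0..}\<close> by (auto intro!: derivative_eq_intros)
    then show ?thesis
      by (rule continuous_at_imp_continuous_at_within[OF DERIV_isCont])
  qed
qed

text \<open>The sine is the distance from 1 to the line through 0 at angle
  \<open>2 * pi * t\<close>, on which \<open>ray_exp s t\<close> lies.\<close>

lemma abs_sin_le_norm_one_minus_ray_exp: "\<bar>sin (2 * pi * t)\<bar> \<le> norm (1 - ray_exp s t)"
proof -
  let ?r = "exp (- (2 * pi * s * t))"
  have "(sin (2 * pi * t))\<^sup>2 \<le> (?r - cos (2 * pi * t))\<^sup>2 + (sin (2 * pi * t))\<^sup>2" by simp
  also have "\<dots> = (norm (1 - ray_exp s t))\<^sup>2"
    unfolding norm_one_minus_ray_exp_squared by (simp add: power2_diff sin_squared_eq)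
  finally have "\<bar>sin (2 * pi * t)\<bar>\<^sup>2 \<le> (norm (1 - ray_exp s t))\<^sup>2" by simp
  then show ?thesis by (rule power2_le_imp_le) simp
qed

lemma two_pi_pos: "0 < 2 * pi" by simp

text \<open>On the ray of slope \<open>s\<close> the value at \<open>t = 1\<close> is explicit; the logarithm is then integrated up to
  \<open>t = 1.01\<close>. For small \<open>s\<close> the distance of the exponential to 1 is bounded below by a sine.\<close>

lemma ray_p_ge_small_slope:
  assumes "0 < s" "s \<le> 8 / 100"
  shows "- (63 / 1000) \<le> ray_p s (101 / 100)"
proof -
  \<comment> \<open>An antiderivative of \<open>ln (6.2 * (t - 1))\<close>, written through
    \<open>x * ln x\<close> so that \<open>continuous_on_x_ln\<close> applies. The factor 6.2 lies
    below \<open>2 * 3.1415 * 0.998\<close>, the slope of the lower bound for the sine.\<close>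
  define G where "G t = 10 / 62 * (62 / 10 * (t - 1) * ln (62 / 10 * (t - 1))) - (t - 1)" for t :: real
  have "ray_p s 1 - G 1 \<le> ray_p s (101 / 100) - G (101 / 100)"
  proof (rule DERIV_nonneg_imp_increasing_open[where f = "\<lambda>t. ray_p s t - G t"])
    fix t :: real assume t: "1 < t" "t < 101 / 100"
    define \<theta> where "\<theta> = 2 * pi * (t - 1)"
    have "2 * pi * (t - 1) \<le> 2 * (31416 / 10000) * (1 / 100)"
      using t pi_bounds by (intro mult_mono) auto
    then have \<theta>: "0 < \<theta>" "\<theta> \<le> 63 / 1000" using t by (auto simp: \<theta>_def)
    have "(2 * (31415 / 10000) * (t - 1)) * (998 / 1000) \<le> \<theta> * cos \<theta>"
    proof (rule mult_mono)
      show "2 * (31415 / 10000) * (t - 1) \<le> \<theta>"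
        unfolding \<theta>_def using t pi_bounds by (intro mult_right_mono) auto
      have "1 - (63 / 1000)\<^sup>2 / 2 \<le> cos \<theta>" using \<theta> by (intro cos_ge_of_abs_le) auto
      then show "998 / 1000 \<le> cos \<theta>" by (simp add: power2_eq_square)
    qed (use \<theta> in auto)
    also have "\<dots> \<le> sin \<theta>" using \<theta> pi_bounds by (intro x_cos_le_sin) auto
    also have "\<dots> = sin (2 * pi * t)" by (simp add: \<theta>_def right_diff_distrib sin_diff)
    also have "\<dots> \<le> norm (1 - ray_exp s t)"
      using abs_sin_le_norm_one_minus_ray_exp[of t s] by linarith
    finally have le: "62 / 10 * (t - 1) \<le> norm (1 - ray_exp s t)" using t by simp
    have ln_le: "ln (62 / 10 * (t - 1)) \<le> ln (norm (1 - ray_exp s t))"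
      using t by (intro ln_mono le) auto
    have "((\<lambda>x::real. x * ln x) has_real_derivative ln (62 / 10 * (t - 1)) + 1) (at (62 / 10 * (t - 1)))"
      using t by (auto intro!: derivative_eq_intros)
    then have "((\<lambda>t. 62 / 10 * (t - 1) * ln (62 / 10 * (t - 1))) has_real_derivative
        (ln (62 / 10 * (t - 1)) + 1) * (62 / 10)) (at t)"
      by (rule DERIV_chain2) (auto intro!: derivative_eq_intros)
    then have "(G has_real_derivative 10 / 62 * ((ln (62 / 10 * (t - 1)) + 1) * (62 / 10)) - (1 - 0)) (at t)"
      unfolding G_def by (intro DERIV_diff DERIV_cmult DERIV_ident DERIV_const)
    moreover have "10 / 62 * ((L + 1) * (62 / 10)) - (1 - 0) = L" for L :: real
      by (simp add: field_simps)
    ultimately have "(G has_real_derivative ln (62 / 10 * (t - 1))) (at t)"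
      by metis
    then have "((\<lambda>t. ray_p s t - G t) has_real_derivative
        ln (norm (1 - ray_exp s t)) - ln (62 / 10 * (t - 1))) (at t)"
      using t assms by (intro DERIV_diff ray_p_has_real_derivative) auto
    with ln_le show "\<exists>y. ((\<lambda>t. ray_p s t - G t) has_real_derivative y) (at t) \<and> 0 \<le> y"
      by (intro exI[of _ "ln (norm (1 - ray_exp s t)) - ln (62 / 10 * (t - 1))"]) auto
  next
    have 1: "continuous_on {1..101 / 100} (\<lambda>t::real. 62 / 10 * (t - 1) * ln (62 / 10 * (t - 1)))"
      by (rule continuous_on_compose2[OF continuous_on_x_ln]) (auto intro!: continuous_intros)
    have 2: "continuous_on {1..101 / 100} (ray_p s)"
      by (rule continuous_on_subset[OF continuous_on_ray_p]) (use assms in auto)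
    have "continuous_on {1..101 / 100} (\<lambda>t::real. t - 1)" by (intro continuous_intros)
    from continuous_on_diff[OF 2 continuous_on_diff[OF continuous_on_mult_left[OF 1] this]]
    show "continuous_on {1..101 / 100} (\<lambda>t. ray_p s t - G t)"
      by (simp only: G_def)
  qed simp
  moreover have "- (38 / 1000) \<le> G (101 / 100)"
  proof -
    have "ln (1000 / 62) \<le> (14 / 5 :: real)"
      using ln_le_ratio[of "1000 / 62" 5 14] by (simp add: power_divide)
    then have "- (14 / 5) \<le> ln (62 / 1000 :: real)" by (simp add: ln_div)
    then show ?thesis by (simp add: G_def)
  qed
  moreover have "G 1 = 0" by (simp add: G_def)
  moreover have "- (15 / 1000) \<le> ray_p s 1"
  proof -
    have "2 * pi * s \<le> 2 * (31416 / 10000) * (8 / 100)"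
      using assms pi_bounds by (intro mult_mono) auto
    then have "497 / 1000 \<le> exp (- (2 * pi * s))"
      using exp_ge_add_one_self[of "- (2 * pi * s)"] by linarith
    then have "(pi\<^sup>2 / 6 - exp (- (2 * pi * s))) * s \<le> (1149 / 1000) * (8 / 100)"
      using assms pi_squared_bounds by (intro mult_mono) auto
    also have "\<dots> \<le> 15 / 1000 * (2 * pi)" using pi_bounds by simp
    finally have "(pi\<^sup>2 / 6 - exp (- (2 * pi * s))) * s / (2 * pi) \<le> 15 / 1000"
      by (simp only: pos_divide_le_eq two_pi_pos)
    moreover have "- ((pi\<^sup>2 / 6 - exp (- (2 * pi * s))) * s / (2 * pi)) \<le> ray_p s 1"
      by (intro ray_p_ge_of_real ray_exp_1) (use assms in auto)
    ultimately show ?thesis by linarith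
  qed
  ultimately show ?thesis by linarith
qed

text \<open>For these slopes the exponential has modulus at most 2/3, so the logarithm is at least
  \<open>- ln 3 >= -1.1\<close> and the step from 1 to 1.01 costs at most 0.011. The value at
  \<open>t = 1\<close> may then be as low as -0.051.\<close>

lemma ray_p_ge_large_slope:
  assumes "8 / 100 \<le> s" "s \<le> 225 / 1000"
  shows "- (63 / 1000) \<le> ray_p s (101 / 100)"
proof -
  have s: "0 < s" using assms by simp
  have "ray_p s 1 + 11 / 10 * 1 \<le> ray_p s (101 / 100) + 11 / 10 * (101 / 100)"
  proof (rule DERIV_nonneg_imp_increasing_open[where f = "\<lambda>t. ray_p s t + 11 / 10 * t"])
    fix t :: real assume t: "1 < t" "t < 101 / 100"
    have "2 * (31415 / 10000) * (8 / 100) * 1 \<le> 2 * pi * s * t"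
      using t assms pi_bounds by (intro mult_mono) auto
    then have "3 / 2 \<le> exp (2 * pi * s * t)"
      using exp_ge_add_one_self[of "2 * pi * s * t"] by linarith
    then have "exp (- (2 * pi * s * t)) \<le> 2 / 3"
      by (simp add: exp_minus field_simps)
    then have "1 / 3 \<le> norm (1 - ray_exp s t)"
      using norm_triangle_ineq2[of 1 "ray_exp s t"] by (simp add: norm_ray_exp)
    then have "ln (1 / 3) \<le> ln (norm (1 - ray_exp s t))" by (intro ln_mono) auto
    moreover have "ln 3 \<le> (11 / 10 :: real)"
      using ln_le_ratio[of 3 10 11] by (simp add: power_divide)
    ultimately have "- (11 / 10) \<le> ln (norm (1 - ray_exp s t))" by (simp add: ln_div)
    moreover have "((\<lambda>t. ray_p s t + 11 / 10 * t) has_real_derivative ln (norm (1 - ray_exp s t)) + 11 / 10) (at t)"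
      using t s by (auto intro!: derivative_eq_intros ray_p_has_real_derivative)
    ultimately show "\<exists>y. ((\<lambda>t. ray_p s t + 11 / 10 * t) has_real_derivative y) (at t) \<and> 0 \<le> y"
      by (intro exI[of _ "ln (norm (1 - ray_exp s t)) + 11 / 10"]) auto
  next
    have "continuous_on {1..101 / 100} (ray_p s)"
      by (rule continuous_on_subset[OF continuous_on_ray_p]) (use s in auto)
    then show "continuous_on {1..101 / 100} (\<lambda>t. ray_p s t + 11 / 10 * t)"
      by (intro continuous_intros)
  qed simp
  moreover have "- (51 / 1000) \<le> ray_p s 1"
  proof -
    have "17 / 12 \<le> ln (25 / 6 :: real)"
      using ratio_le_ln[of "25 / 6" 12 17] by (simp add: power_divide)
    then have "ln (6 / 25) \<le> - (17 / 12 :: real)" by (simp add: ln_div)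
    moreover have "2 * pi * s \<le> 2 * (31416 / 10000) * (225 / 1000)"
      using assms pi_bounds by (intro mult_mono) auto
    ultimately have "ln (6 / 25) \<le> - (2 * pi * s)" by linarith
    then have "6 / 25 \<le> exp (- (2 * pi * s))"
      using exp_le_cancel_iff[of "ln (6 / 25)" "- (2 * pi * s)"] by simp
    then have "(pi\<^sup>2 / 6 - exp (- (2 * pi * s))) * s \<le> (1406 / 1000) * (225 / 1000)"
      using assms pi_squared_bounds by (intro mult_mono) auto
    also have "\<dots> \<le> 51 / 1000 * (2 * pi)" using pi_bounds by simp
    finally have "(pi\<^sup>2 / 6 - exp (- (2 * pi * s))) * s / (2 * pi) \<le> 51 / 1000"
      by (simp only: pos_divide_le_eq two_pi_pos)
    moreover have "- ((pi\<^sup>2 / 6 - exp (- (2 * pi * s))) * s / (2 * pi)) \<le> ray_p s 1"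
      by (intro ray_p_ge_of_real ray_exp_1) (use s in auto)
    ultimately show ?thesis by linarith
  qed
  ultimately show ?thesis by linarith
qed

text \<open>Since \<open>norm (1 - ray_exp s t) <= 2\<close>, the derivative is at most
  \<open>ln 2 <= 0.7\<close>, and going back from 3/2 to 1.49 costs at most 0.007.\<close>

lemma ray_p_ge_at_149:
  assumes "0 < s" "s \<le> 225 / 1000"
  shows "- (9 / 100) \<le> ray_p s (149 / 100)"
proof -
  have "7 / 10 * (149 / 100) - ray_p s (149 / 100) \<le> 7 / 10 * (3 / 2) - ray_p s (3 / 2)"
  proof (rule DERIV_nonneg_imp_increasing_open[where f = "\<lambda>t. 7 / 10 * t - ray_p s t"])
    fix t :: real assume t: "149 / 100 < t" "t < 3 / 2"
    have "norm (ray_exp s t) < 1" using t assms by (simp add: norm_ray_exp)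
    then have "norm (1 - ray_exp s t) \<le> 2" "1 - ray_exp s t \<noteq> 0"
      using norm_triangle_ineq4[of 1 "ray_exp s t"] by auto
    then have "ln (norm (1 - ray_exp s t)) \<le> ln 2" by (intro ln_mono) auto
    moreover have "ln 2 \<le> (7 / 10 :: real)"
      using ln_le_ratio[of 2 10 7] by (simp add: power_divide)
    moreover have "((\<lambda>t. 7 / 10 * t - ray_p s t) has_real_derivative 7 / 10 - ln (norm (1 - ray_exp s t))) (at t)"
      using t assms by (auto intro!: derivative_eq_intros ray_p_has_real_derivative)
    ultimately show "\<exists>y. ((\<lambda>t. 7 / 10 * t - ray_p s t) has_real_derivative y) (at t) \<and> 0 \<le> y"
      by (intro exI[of _ "7 / 10 - ln (norm (1 - ray_exp s t))"]) auto
  next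
    have "continuous_on {149 / 100..3 / 2} (ray_p s)"
      by (rule continuous_on_subset[OF continuous_on_ray_p]) (use assms in auto)
    then show "continuous_on {149 / 100..3 / 2} (\<lambda>t. 7 / 10 * t - ray_p s t)"
      by (intro continuous_intros)
  qed simp
  moreover have "- (8 / 100) \<le> ray_p s (3 / 2)"
  proof -
    \<comment> \<open>The product \<open>s * exp (- (3 * pi * s))\<close> is bounded by 1/9
      uniformly in the slope, from \<open>exp x >= x\<close>.\<close>
    have "9 * s \<le> 3 * pi * s" using assms pi_bounds by (intro mult_right_mono) auto
    then have "9 * s \<le> exp (3 * pi * s)" using exp_ge_add_one_self[of "3 * pi * s"] by linarith
    then have "exp (- (3 * pi * s)) * s \<le> 1 / 9"
      by (simp add: exp_minus field_simps)
    moreover have "pi\<^sup>2 / 6 * s \<le> (1645 / 1000) * (225 / 1000)"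
      using assms pi_squared_bounds by (intro mult_mono) auto
    ultimately have "(pi\<^sup>2 / 6 - - exp (- (3 * pi * s))) * s \<le> 482 / 1000"
      by (simp add: algebra_simps)
    also have "\<dots> \<le> 8 / 100 * (2 * pi)" using pi_bounds by simp
    finally have "(pi\<^sup>2 / 6 - - exp (- (3 * pi * s))) * s / (2 * pi) \<le> 8 / 100"
      by (simp only: pos_divide_le_eq two_pi_pos)
    moreover have "- ((pi\<^sup>2 / 6 - - exp (- (3 * pi * s))) * s / (2 * pi)) \<le> ray_p s (3 / 2)"
    proof (intro ray_p_ge_of_real ray_exp_3_halves)
      show "- exp (- (3 * pi * s)) < 1"
      using exp_gt_zero[of "- (3 * pi * s)"] by linarith
      show "\<bar>- exp (- (3 * pi * s))\<bar> \<le> 1"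
        using assms by simp
    qed (use assms in auto)
    ultimately show ?thesis by linarith
  qed
  ultimately show ?thesis by simp
qed

text \<open>Dividing by \<open>t\<close> settles positive slopes; slope 0 follows by passing to the
  limit from the right.\<close>

lemma Re_p_ge_of_ray_p_ge:
  assumes "0 < t" "0 \<le> s" "s \<le> m" "0 < m" "\<And>s. 0 < s \<Longrightarrow> s \<le> m \<Longrightarrow> t * b \<le> ray_p s t"
  shows "b \<le> Re (p (of_real t * Complex 1 s))"
proof -
  have pos: "b \<le> Re (p (of_real t * Complex 1 s))" if "0 < s" "s \<le> m" for s
    using assms(5)[OF that] assms(1) by (simp add: ray_p_def)
  show ?thesis
  proof (cases "s = 0")
    case True
    have "\<forall>\<^sub>F s in at_right 0. b \<le> Re (p (of_real t * Complex 1 s))"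
      using eventually_at_right_less[of "0::real"] eventually_at_right_real[OF \<open>0 < m\<close>]
      by eventually_elim (use pos in auto)
    then have "b \<le> Re (p (of_real t))"
      by (intro tendsto_lowerbound[OF Re_p_tendsto_slope_0[OF assms(1)]]) auto
    moreover have "of_real t * Complex 1 s = of_real t" using True by (simp add: complex_eq_iff)
    ultimately show ?thesis by (simp only:)
  qed (use pos assms in auto)
qed

lemma Re_p_P1:
  assumes "0 \<le> s" "s \<le> v"
  shows "ln (norm w\<^sub>0) < Re (p (of_real (101 / 100) * Complex 1 s))"
proof -
  \<comment> \<open>Division by 1.01 lifts the bound strictly above -0.063, which makes the final
    inequality strict.\<close>
  have "- (63 / 1000) / (101 / 100) \<le> Re (p (of_real (101 / 100) * Complex 1 s))"
  proof (rule Re_p_ge_of_ray_p_ge[of _ _ v])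
    fix s assume "0 < s" "s \<le> v"
    then have "- (63 / 1000) \<le> ray_p s (101 / 100)"
      using v_bounds ray_p_ge_small_slope[of s] ray_p_ge_large_slope[of s]
      by (cases "s \<le> 8 / 100") auto
    then show "101 / 100 * (- (63 / 1000) / (101 / 100)) \<le> ray_p s (101 / 100)" by simp
  qed (use assms v_bounds in auto)
  then show ?thesis using ln_norm_w0 by simp
qed

lemma Re_p_P3:
  assumes "0 \<le> s" "s \<le> v"
  shows "ln (norm w\<^sub>0) < Re (p (of_real (149 / 100) * Complex 1 s))"
proof -
  \<comment> \<open>The quotient is about -0.0604, above the threshold -0.063.\<close>
  have "- (9 / 100) / (149 / 100) \<le> Re (p (of_real (149 / 100) * Complex 1 s))"
  proof (rule Re_p_ge_of_ray_p_ge[of _ _ v])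
    fix s assume "0 < s" "s \<le> v"
    then have "- (9 / 100) \<le> ray_p s (149 / 100)"
      using v_bounds by (intro ray_p_ge_at_149) auto
    then show "149 / 100 * (- (9 / 100) / (149 / 100)) \<le> ray_p s (149 / 100)" by simp
  qed (use assms v_bounds in auto)
  then show ?thesis using ln_norm_w0 by simp
qed

text \<open>The points of a vertical segment share \<open>t\<close> and differ only in slope, so an
  estimate at fixed \<open>t\<close>, uniform in the slope, covers the segment.\<close>

lemma vertical_segment:
  assumes "z \<in> closed_segment (of_real t) (of_real t * c)"
  shows "\<exists>s. 0 \<le> s \<and> s \<le> v \<and> z = of_real t * Complex 1 s"
proof -
  from assms obtain u where u: "0 \<le> u" "u \<le> 1" "z = (1 - u) *\<^sub>R of_real t + u *\<^sub>R (of_real t * c)"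
    by (auto simp: in_segment)
  have "z = of_real t * Complex 1 (u * v)"
    using u by (simp add: complex_eq_iff c_def algebra_simps)
  moreover have "0 \<le> u * v" "u * v \<le> v"
    using u v_bounds by (auto intro: mult_left_le_one_le)
  ultimately show ?thesis by blast
qed

lemma c_eq: "c = Complex 1 v"
  by (simp add: c_def complex_eq_iff)

lemma z0_in_P2: "z\<^sub>0 \<in> P\<^sub>2"
  unfolding P\<^sub>2_def c_eq using z0_eq Re_z0_bounds
  by (intro CollectI exI[of _ "Re z\<^sub>0"]) (auto simp: mult.commute)

lemma ln_norm_w0_less_Re_p:
  assumes "z \<in> \<P>" "z \<noteq> z\<^sub>0"
  shows "ln (norm w\<^sub>0) < Re (p z)"
proof -
  have decimals: "(1.01 :: complex) = of_real (101 / 100)" "(1.49 :: complex) = of_real (149 / 100)"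
    by simp_all
  consider "z \<in> P\<^sub>1" | "z \<in> P\<^sub>2" | "z \<in> P\<^sub>3"
    using assms(1) by (auto simp: \<P>_def)
  then show ?thesis
  proof cases
    case 1
    then show ?thesis
      unfolding P\<^sub>1_def decimals using vertical_segment Re_p_P1 by blast
  next
    case 2
    then obtain t where t: "z = of_real t * Complex 1 v" "1.01 \<le> t" "t \<le> 1.49"
      unfolding P\<^sub>2_def c_eq by (auto simp: mult.commute)
    then have "t \<noteq> Re z\<^sub>0" using assms(2) z0_eq by auto
    then show ?thesis unfolding t(1) using t by (intro Re_p_P2) auto
  next
    case 3
    then have "z \<in> closed_segment (of_real (149 / 100)) (of_real (149 / 100) * c)"
      unfolding P\<^sub>3_def decimals by (simp only: closed_segment_commute)
    then show ?thesis using vertical_segment Re_p_P3 by blast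
  qed
qed

theorem theorem5p2:
  shows "z\<^sub>0 \<in> \<P> \<and> (\<forall>z\<in>\<P>. z \<noteq> z\<^sub>0 \<longrightarrow> Re (p z - p z\<^sub>0) > 0)"
proof (intro conjI ballI impI)
  show "z\<^sub>0 \<in> \<P>" using z0_in_P2 by (simp add: \<P>_def)
  fix z assume "z \<in> \<P>" "z \<noteq> z\<^sub>0"
  then show "Re (p z - p z\<^sub>0) > 0"
    using ln_norm_w0_less_Re_p w0_nonzero by (simp add: p_z0)
qed

end
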